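(* Let $n,p$ be positive integers, let $\mathcal{A},\mathcal{B},\mathcal{A}',\mathcal{B}'\in\mathbb{H}^{n\times n\times p}_{++}$ and $\mathcal{C}\in\mathbb{H}^{n\times n\times p}$. Then: (i) If $\mathcal{A}<\mathcal{B}$, then $\mathcal{B}^{-1}<\mathcal{A}^{-1}$. (ii) (Harmonic-geometric-arithmetic mean inequality) $2(\mathcal{A}^{-1}+\mathcal{B}^{-1})^{-1}\le\mathcal{A}\#\mathcal{B}\le\frac12(\mathcal{A}+\mathcal{B})$. (iii) (Monotone property) If $\mathcal{A}'\le\mathcal{A}$ and $\mathcal{B}'\le\mathcal{B}$, then $\mathcal{A}'\#\mathcal{B}'\le\mathcal{A}\#\mathcal{B}$. (iv) (Löwner-Heinz inequality) If $\mathcal{C}^2\le\mathcal{A}\le\mathcal{B}$, then $\mathcal{C}\le\mathcal{A}^{1/2}\le\mathcal{B}^{1/2}$.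
   Context: A tensor $\mathcal{A}\in\mathbb{C}^{m\times n\times p}$ has frontal slices $A^{(1)},\dots,A^{(p)}\in\mathbb{C}^{m\times n}$. $\operatorname{bcirc}(\mathcal{A})\in\mathbb{C}^{mp\times np}$ is the block circulant matrix whose $(j,l)$ block is $A^{(((j-l)\bmod p)+1)}$ (first block column $A^{(1)},\dots,A^{(p)}$); $\operatorname{unfold}(\mathcal{A})$ is the block column $A^{(1)},\dots,A^{(p)}$, and $\operatorname{fold}$ is its inverse. The T-product is $\mathcal{A}*\mathcal{B}=\operatorname{fold}(\operatorname{bcirc}(\mathcal{A})\cdot\operatorname{unfold}(\mathcal{B}))$; powers such as $\mathcal{C}^2$ are with respect to $*$. The identity tensor $\mathcal{I}_{n,p}$ has first frontal slice $I_n$ and all others zero; inverses are taken with respect to $*$ and $\mathcal{I}_{n,p}$. The T-conjugate transpose $\mathcal{A}^H$ has frontal slices $(A^{(1)})^H,(A^{(p)})^H,\dots,(A^{(2)})^H$, in this order. $\mathbb{H}^{n\times n\times p}$ is the set of T-Hermitian tensors, i.e. $\mathcal{A}\in\mathbb{C}^{n\times n\times p}$ with $\mathcal{A}^H=\mathcal{A}$. With $\langle\mathcal{A},\mathcal{B}\rangle=\sum_{i,j,k}\overline{a_{ijk}}b_{ijk}$, a tensor $\mathcal{A}\in\mathbb{H}^{n\times n\times p}$ is T-positive definite (resp. semidefinite) if $\langle\mathcal{X},\mathcal{A}*\mathcal{X}\rangle>0$ (resp. $\ge0$) for all nonzero $\mathcal{X}\in\mathbb{C}^{n\times1\times p}$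 (equivalently, $\operatorname{bcirc}(\mathcal{A})$ is Hermitian positive definite (resp. semidefinite)); the sets of these are $\mathbb{H}^{n\times n\times p}_{++}$ (resp. $\mathbb{H}^{n\times n\times p}_{+}$). Each $\mathcal{A}\in\mathbb{H}^{n\times n\times p}_{++}$ is invertible and has a unique T-positive definite square root $\mathcal{A}^{1/2}$; $\mathcal{A}^{-1/2}=(\mathcal{A}^{1/2})^{-1}$. The geometric mean is $\mathcal{A}\#\mathcal{B}=\mathcal{A}^{1/2}*(\mathcal{A}^{-1/2}*\mathcal{B}*\mathcal{A}^{-1/2})^{1/2}*\mathcal{A}^{1/2}$. T-Löwner order on $\mathbb{H}^{n\times n\times p}$: $\mathcal{A}<\mathcal{B}$ (resp. $\mathcal{A}\le\mathcal{B}$) means $\mathcal{B}-\mathcal{A}\in\mathbb{H}^{n\times n\times p}_{++}$ (resp. $\mathbb{H}^{n\times n\times p}_{+}$). *)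

theory Defs
  imports "Jordan_Normal_Form.Schur_Decomposition"
begin

text \<open>
  An m x n x p tensor is the list of its p frontal slices, each an m x n complex matrix; the slice
  A^(k) of the mathematical (1-based) notation is the list element with index k - 1. The dimensions
  of a tensor are read off from its first slice and its length, which is meaningful for p > 0.
\<close>

type_synonym tensor = "complex mat list"

definition tensor_carrier :: "nat \<Rightarrow> nat \<Rightarrow> nat \<Rightarrow> tensor set" where
  "tensor_carrier m n p = {A. length A = p \<and> (\<forall>k<p. A ! k \<in> carrier_mat m n)}"

definition trows :: "tensor \<Rightarrow> nat" where
  "trows A = dim_row (A ! 0)"

definition tcols :: "tensor \<Rightarrow> nat" where
  "tcols A = dim_col (A ! 0)"

definition tdepth :: "tensor \<Rightarrow> nat" where
  "tdepth A = length A"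

text \<open>
  With 0-based j, l < p the (j, l) block is the slice number (j - l) mod p, written
  (j + p - l) mod p because subtraction on nat truncates.
\<close>

definition bcirc :: "tensor \<Rightarrow> complex mat" where
  "bcirc A = (let m = trows A; n = tcols A; p = tdepth A in
     mat (m * p) (n * p)
       (\<lambda>(r, c). A ! ((r div m + p - c div n) mod p) $$ (r mod m, c mod n)))"

definition tunfold :: "tensor \<Rightarrow> complex mat" where
  "tunfold A = (let m = trows A in
     mat (m * tdepth A) (tcols A) (\<lambda>(r, c). A ! (r div m) $$ (r mod m, c)))"

text \<open>The inverse of unfolding needs the number p of blocks, which the matrix does not determine.\<close>

definition tfold :: "nat \<Rightarrow> complex mat \<Rightarrow> tensor" where
  "tfold p M = (let m = dim_row M div p in
     map (\<lambda>k. mat m (dim_col M) (\<lambda>(i, c). M $$ (k * m + i, c))) [0..<p])"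

definition tprod :: "tensor \<Rightarrow> tensor \<Rightarrow> tensor" (infixl "*\<^sub>T" 70) where
  "A *\<^sub>T B = tfold (tdepth A) (bcirc A * tunfold B)"

definition tadd :: "tensor \<Rightarrow> tensor \<Rightarrow> tensor" (infixl "+\<^sub>T" 65) where
  "A +\<^sub>T B = map2 (+) A B"

definition tminus :: "tensor \<Rightarrow> tensor \<Rightarrow> tensor" (infixl "-\<^sub>T" 65) where
  "A -\<^sub>T B = map2 (-) A B"

definition tsmult :: "complex \<Rightarrow> tensor \<Rightarrow> tensor" (infixr "\<cdot>\<^sub>T" 75) where
  "c \<cdot>\<^sub>T A = map (\<lambda>M. c \<cdot>\<^sub>m M) A"

definition tzero :: "nat \<Rightarrow> nat \<Rightarrow> nat \<Rightarrow> tensor" where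
  "tzero m n p = replicate p (0\<^sub>m m n)"

definition tident :: "nat \<Rightarrow> nat \<Rightarrow> tensor" where
  "tident n p = map (\<lambda>k. if k = 0 then 1\<^sub>m n else 0\<^sub>m n n) [0..<p]"

text \<open>The slices of the T-conjugate transpose are the adjoints of A^(1), A^(p), ..., A^(2).\<close>

definition tadjoint :: "tensor \<Rightarrow> tensor" where
  "tadjoint A = map mat_adjoint (hd A # rev (tl A))"

definition tinner :: "tensor \<Rightarrow> tensor \<Rightarrow> complex" where
  "tinner A B = (\<Sum>i<trows A. \<Sum>j<tcols A. \<Sum>k<tdepth A. cnj (A ! k $$ (i, j)) * B ! k $$ (i, j))"

definition T_Herm :: "nat \<Rightarrow> nat \<Rightarrow> tensor set" where
  "T_Herm n p = {A \<in> tensor_carrier n n p. tadjoint A = A}"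

text \<open>
  The order on complex numbers is that of HOL-Library.Complex_Order: \<open>0 < z\<close> (resp. \<open>0 \<le> z\<close>)
  says that z is real and positive (resp. real and nonnegative).
\<close>

definition T_PD :: "nat \<Rightarrow> nat \<Rightarrow> tensor set" where
  "T_PD n p = {A \<in> T_Herm n p.
     \<forall>X \<in> tensor_carrier n 1 p. X \<noteq> tzero n 1 p \<longrightarrow> 0 < tinner X (A *\<^sub>T X)}"

definition T_PSD :: "nat \<Rightarrow> nat \<Rightarrow> tensor set" where
  "T_PSD n p = {A \<in> T_Herm n p.
     \<forall>X \<in> tensor_carrier n 1 p. X \<noteq> tzero n 1 p \<longrightarrow> 0 \<le> tinner X (A *\<^sub>T X)}"

text \<open>
  The inverse and the square root are used for T-positive definite tensors only, where they exist
  and are unique.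
\<close>

definition tinv :: "tensor \<Rightarrow> tensor" where
  "tinv A = (let n = trows A; p = tdepth A in
     THE X. X \<in> tensor_carrier n n p \<and> A *\<^sub>T X = tident n p \<and> X *\<^sub>T A = tident n p)"

definition tsqrt :: "tensor \<Rightarrow> tensor" where
  "tsqrt A = (THE S. S \<in> T_PD (trows A) (tdepth A) \<and> S *\<^sub>T S = A)"

definition tgmean :: "tensor \<Rightarrow> tensor \<Rightarrow> tensor" (infixl "#\<^sub>T" 68) where
  "A #\<^sub>T B =
     tsqrt A *\<^sub>T tsqrt (tinv (tsqrt A) *\<^sub>T B *\<^sub>T tinv (tsqrt A)) *\<^sub>T tsqrt A"

text \<open>
  The T-Loewner order is a relation on the T-Hermitian tensors of a common size, so membership of
  both sides is part of the relation.
\<close>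

definition tless :: "tensor \<Rightarrow> tensor \<Rightarrow> bool" (infix "<\<^sub>T" 50) where
  "A <\<^sub>T B \<longleftrightarrow> (let n = trows A; p = tdepth A in
     A \<in> T_Herm n p \<and> B \<in> T_Herm n p \<and> B -\<^sub>T A \<in> T_PD n p)"

definition tless_eq :: "tensor \<Rightarrow> tensor \<Rightarrow> bool" (infix "\<le>\<^sub>T" 50) where
  "A \<le>\<^sub>T B \<longleftrightarrow> (let n = trows A; p = tdepth A in
     A \<in> T_Herm n p \<and> B \<in> T_Herm n p \<and> B -\<^sub>T A \<in> T_PSD n p)"

end

theory Submission
  imports Defs
begin

text \<open>
  Passing from a tensor to its block circulant matrix turns the T-product into the matrix product, the
  T-conjugate transpose into the adjoint, and the inner product that defines T-positivity into the
  quadratic form of that matrix (\<open>bcirc_tprod\<close>, \<open>bcirc_tadjoint\<close>, \<open>tinner_tprod\<close>). The four claims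
  therefore follow from the same claims about Hermitian matrices, provided that inverses and positive
  definite square roots of block circulant matrices are again block circulant. The latter holds because
  the block circulant matrices are the matrices that are invariant under conjugation by the cyclic shift
  of the blocks (\<open>bcirc_shift_invariant\<close>, \<open>shift_invariant_imp_bcirc\<close>): conjugation by this unitary matrix
  maps an inverse or a positive definite square root to another one, and both are unique
  (\<open>tinv_T_PD\<close>, \<open>tsqrt_T_PD\<close>).

  For matrices, everything rests on two facts. The first is \<open>psd_diff_of_square_le\<close>: if \<open>C\<^sup>2 \<le> S\<^sup>2\<close> with \<open>S\<close>
  positive definite and \<open>C\<close> Hermitian, then \<open>C \<le> S\<close>. An eigenvector of \<open>S - C\<close> for a negative eigenvalue would
  be stretched more by \<open>C\<close> than by \<open>S\<close>. This is the Loewner-Heinz inequality, and it also gives the uniqueness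
  of square roots; their existence comes from the unitary diagonalization of Hermitian matrices. The second
  is the identity \<open>inverse_difference\<close>, which exhibits \<open>A\<^sup>-\<^sup>1 - B\<^sup>-\<^sup>1\<close> as a sum of congruence images of \<open>B - A\<close>
  and \<open>A\<^sup>-\<^sup>1\<close>, so that inversion reverses the order.

  The geometric mean \<open>G\<close> of \<open>A\<close> and \<open>B\<close> satisfies the Riccati equation \<open>G A\<^sup>-\<^sup>1 G = B\<close>
  (\<open>geometric_mean_riccati\<close>). Consequently \<open>A + B - 2 G = (A - G) A\<^sup>-\<^sup>1 (A - G)\<close>, which is the
  arithmetic-geometric mean inequality; applied to \<open>A\<^sup>-\<^sup>1\<close>, \<open>B\<^sup>-\<^sup>1\<close> and \<open>G\<^sup>-\<^sup>1\<close> it yields the harmonic one.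
  Finally, \<open>G\<close> is the largest Hermitian \<open>X\<close> with \<open>X A\<^sup>-\<^sup>1 X \<le> B\<close> (\<open>riccati_solution_maximal\<close>), and this condition
  becomes weaker as \<open>A\<close> and \<open>B\<close> grow, which is monotonicity.
\<close>

section \<open>Adjoints of complex matrices\<close>

declare minus_carrier_mat [simp]

lemma dim_mat_adjoint [simp]:
  "dim_row (mat_adjoint A) = dim_col A" "dim_col (mat_adjoint A) = dim_row A"
  by (simp_all add: mat_adjoint_def)

lemma mat_adjoint_carrier [simp]:
  "A \<in> carrier_mat m n \<Longrightarrow> mat_adjoint A \<in> carrier_mat n m"
  by (intro carrier_matI) auto

lemma mat_adjoint_index [simp]:
  fixes A :: "complex mat"
  shows "i < dim_col A \<Longrightarrow> j < dim_row A \<Longrightarrow> mat_adjoint A $$ (i, j) = cnj (A $$ (j, i))"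
  by (simp add: mat_adjoint_def mat_of_rows_index)

lemma mat_adjoint_mat_adjoint [simp]: "mat_adjoint (mat_adjoint A) = (A :: complex mat)"
  by (rule eq_matI) auto

lemma mat_adjoint_mult:
  fixes A :: "complex mat"
  assumes "A \<in> carrier_mat m k" "B \<in> carrier_mat k n"
  shows "mat_adjoint (A * B) = mat_adjoint B * mat_adjoint A"
  using assms by (intro eq_matI) (auto simp: scalar_prod_def mult.commute)

lemma mat_adjoint_add:
  fixes A :: "complex mat"
  assumes "A \<in> carrier_mat m n" "B \<in> carrier_mat m n"
  shows "mat_adjoint (A + B) = mat_adjoint A + mat_adjoint B"
  using assms by (intro eq_matI) auto

lemma mat_adjoint_minus:
  fixes A :: "complex mat"
  assumes "A \<in> carrier_mat m n" "B \<in> carrier_mat m n"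
  shows "mat_adjoint (A - B) = mat_adjoint A - mat_adjoint B"
  using assms by (intro eq_matI) auto

lemma mat_adjoint_smult:
  fixes A :: "complex mat"
  shows "mat_adjoint (c \<cdot>\<^sub>m A) = cnj c \<cdot>\<^sub>m mat_adjoint A"
  by (intro eq_matI) auto

lemma mat_adjoint_one [simp]: "mat_adjoint (1\<^sub>m n :: complex mat) = 1\<^sub>m n"
  by (intro eq_matI) auto

lemma inner_adjoint:
  fixes A :: "complex mat"
  assumes "A \<in> carrier_mat m n" "v \<in> carrier_vec n" "w \<in> carrier_vec m"
  shows "(A *\<^sub>v v) \<bullet>c w = v \<bullet>c (mat_adjoint A *\<^sub>v w)"
proof -
  have "(A *\<^sub>v v) \<bullet>c w = (\<Sum>i<m. \<Sum>j<n. A $$ (i, j) * v $ j * cnj (w $ i))"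
    using assms by (auto simp: scalar_prod_def sum_distrib_right atLeast0LessThan intro!: sum.cong)
  also have "\<dots> = (\<Sum>j<n. \<Sum>i<m. A $$ (i, j) * v $ j * cnj (w $ i))"
    by (rule sum.swap)
  also have "\<dots> = v \<bullet>c (mat_adjoint A *\<^sub>v w)"
    using assms by (auto simp: scalar_prod_def sum_distrib_left atLeast0LessThan mult_ac
        intro!: sum.cong)
  finally show ?thesis .
qed

section \<open>Unitary diagonalization of Hermitian matrices\<close>

definition diag_of :: "nat \<Rightarrow> (nat \<Rightarrow> real) \<Rightarrow> complex mat" where
  "diag_of n d = mat n n (\<lambda>(i, j). if i = j then complex_of_real (d i) else 0)"

lemma diag_of_carrier [simp]: "diag_of n d \<in> carrier_mat n n"
  by (simp add: diag_of_def)

lemma diag_of_mult_vec: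
  assumes "i < n" "v \<in> carrier_vec n"
  shows "(diag_of n d *\<^sub>v v) $ i = complex_of_real (d i) * v $ i"
proof -
  have "(diag_of n d *\<^sub>v v) $ i = (\<Sum>j\<in>{0..<n}. (if i = j then complex_of_real (d i) else 0) * v $ j)"
    using assms by (simp add: diag_of_def scalar_prod_def)
  also have "\<dots> = (\<Sum>j\<in>{0..<n}. if j = i then complex_of_real (d i) * v $ i else 0)"
    by (intro sum.cong) auto
  finally show ?thesis
    using assms by simp
qed

lemma diag_of_mult: "diag_of n d * diag_of n e = diag_of n (\<lambda>i. d i * e i)"
proof (rule eq_matI)
  fix i j assume "i < dim_row (diag_of n (\<lambda>i. d i * e i))" "j < dim_col (diag_of n (\<lambda>i. d i * e i))"
  then have ij: "i < n" "j < n" by (auto simp: diag_of_def)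
  have "(diag_of n d * diag_of n e) $$ (i, j) = (diag_of n d *\<^sub>v col (diag_of n e) j) $ i"
    using ij by (simp add: diag_of_def)
  also have "\<dots> = complex_of_real (d i) * col (diag_of n e) j $ i"
    using ij by (intro diag_of_mult_vec) (auto simp: diag_of_def)
  finally show "(diag_of n d * diag_of n e) $$ (i, j) = diag_of n (\<lambda>i. d i * e i) $$ (i, j)"
    using ij by (simp add: diag_of_def)
qed (auto simp: diag_of_def)

lemma mat_adjoint_diag_of [simp]: "mat_adjoint (diag_of n d) = diag_of n d"
  by (intro eq_matI) (auto simp: diag_of_def)

lemma exists_eigenvector:
  fixes A :: "complex mat"
  assumes A: "A \<in> carrier_mat n n" and n: "n \<noteq> 0"
  obtains v e where "v \<in> carrier_vec n" "v \<noteq> 0\<^sub>v n" "A *\<^sub>v v = e \<cdot>\<^sub>v v"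
proof -
  have "degree (char_poly A) = n"
    using degree_monic_char_poly[OF A] by simp
  then have "\<not> constant (poly (char_poly A))"
    using n by (simp add: constant_degree)
  then obtain e where "poly (char_poly A) e = 0"
    using fundamental_theorem_of_algebra by blast
  then have "eigenvalue A e"
    using eigenvalue_root_char_poly[OF A] by simp
  then show thesis
    using that A unfolding eigenvalue_def eigenvector_def by auto
qed

text \<open>
  The orthogonal basis that the Gram-Schmidt process builds from a completion of \<open>v\<close> keeps \<open>v\<close> as its
  first member, but its members are not normalized; dividing each of them by its length gives the
  columns of a unitary matrix.
\<close>

lemma exists_unitary_first_column:
  fixes v :: "complex vec"
  assumes v: "v \<in> carrier_vec n" "v \<noteq> 0\<^sub>v n"
  obtains U c where "U \<in> carrier_mat n n" "mat_adjoint U * U = 1\<^sub>m n" "col U 0 = c \<cdot>\<^sub>v v"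
proof -
  interpret cof_vec_space n "TYPE(complex)" .
  define b where "b = basis_completion v"
  define ws where "ws = gram_schmidt n b"
  note bc = basis_completion[OF v, folded b_def]
  have n: "n \<noteq> 0"
    using v by (auto intro!: eq_vecI)
  obtain vs where bv: "b = v # vs"
    using bc(6,7) n by (cases b) auto
  note gs = gram_schmidt_result[OF bc(2,4,5) ws_def]
  have len: "length ws = n" using gs bc by simp
  have hd: "ws ! 0 = v"
    using gram_schmidt_hd[OF v(1), of vs] len n unfolding ws_def bv by (cases "gram_schmidt n (v # vs)") auto
  have ws: "ws ! i \<in> carrier_vec n" if "i < n" for i
    using gs(3) len that by (metis nth_mem subsetD)
  have dim_ws: "dim_vec (ws ! i) = n" if "i < n" for i
    using ws[OF that] by simp
  have orth: "(ws ! i \<bullet>c ws ! j = 0) = (i \<noteq> j)" if "i < n" "j < n" for i j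
    using corthogonalD[OF gs(2)] len that by simp
  define r where "r i = sqrt (Re (ws ! i \<bullet>c ws ! i))" for i
  have r: "complex_of_real (r i) * complex_of_real (r i) = ws ! i \<bullet>c ws ! i \<and> r i \<noteq> 0" if "i < n" for i
  proof -
    have ge: "0 \<le> ws ! i \<bullet>c ws ! i" by (rule conjugate_square_ge_0_vec)
    moreover have "ws ! i \<bullet>c ws ! i \<noteq> 0" using orth[OF that that] by simp
    ultimately show ?thesis
      unfolding r_def by (auto simp: less_eq_complex_def complex_eq_iff simp flip: of_real_mult)
  qed
  define U where "U = mat n n (\<lambda>(i, j). ws ! j $ i / complex_of_real (r j))"
  have U: "U \<in> carrier_mat n n" by (simp add: U_def)
  have "mat_adjoint U * U = 1\<^sub>m n"
  proof (rule eq_matI)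
    fix i j assume ij: "i < dim_row (1\<^sub>m n :: complex mat)" "j < dim_col (1\<^sub>m n :: complex mat)"
    then have ij: "i < n" "j < n" by auto
    have "(mat_adjoint U * U) $$ (i, j)
        = (\<Sum>k<n. cnj (ws ! i $ k / complex_of_real (r i)) * (ws ! j $ k / complex_of_real (r j)))"
      using ij U by (auto simp: scalar_prod_def U_def atLeast0LessThan intro!: sum.cong)
    also have "\<dots> = (\<Sum>k<n. ws ! j $ k * cnj (ws ! i $ k)) / (complex_of_real (r i) * complex_of_real (r j))"
      by (simp add: sum_divide_distrib mult_ac)
    also have "(\<Sum>k<n. ws ! j $ k * cnj (ws ! i $ k)) = ws ! j \<bullet>c ws ! i"
      using ij by (simp add: scalar_prod_def atLeast0LessThan dim_ws)
    also have "\<dots> / (complex_of_real (r i) * complex_of_real (r j)) = 1\<^sub>m n $$ (i, j)"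
      using ij r[OF ij(1)] orth[OF ij(2,1)] by (cases "i = j") auto
    finally show "(mat_adjoint U * U) $$ (i, j) = 1\<^sub>m n $$ (i, j)" .
  qed (use U in auto)
  moreover have "col U 0 = (1 / complex_of_real (r 0)) \<cdot>\<^sub>v v"
    using hd n v by (intro eq_vecI) (auto simp: U_def)
  ultimately show thesis using that U by blast
qed

lemma mult_carrier_square [simp]:
  "A \<in> carrier_mat n n \<Longrightarrow> B \<in> carrier_mat n n \<Longrightarrow> A * B \<in> carrier_mat n n"
  by (rule mult_carrier_mat)

lemma mat_adjoint_four_block_diag:
  fixes V :: "complex mat"
  assumes "V \<in> carrier_mat n n"
  shows "mat_adjoint (four_block_mat (1\<^sub>m 1) (0\<^sub>m 1 n) (0\<^sub>m n 1) V)
    = four_block_mat (1\<^sub>m 1) (0\<^sub>m 1 n) (0\<^sub>m n 1) (mat_adjoint V)"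
  using assms by (intro eq_matI) (auto simp: four_block_mat_def Let_def)

lemma mult_four_block_diag:
  fixes V W :: "complex mat"
  assumes "V \<in> carrier_mat n n" "W \<in> carrier_mat n n" "a \<in> carrier_mat 1 1" "b \<in> carrier_mat 1 1"
  shows "four_block_mat a (0\<^sub>m 1 n) (0\<^sub>m n 1) V * four_block_mat b (0\<^sub>m 1 n) (0\<^sub>m n 1) W
    = four_block_mat (a * b) (0\<^sub>m 1 n) (0\<^sub>m n 1) (V * W)"
  using assms by (subst mult_four_block_mat[where ?nr1.0=1 and ?n1.0=1 and ?n2.0=n and ?nr2.0=n and ?nc1.0=1 and ?nc2.0=n]) auto

text \<open>
  Deflation: in a unitary basis that starts with an eigenvector the first column of the matrix is a
  multiple of the first unit vector, and because the matrix is Hermitian so is its first row. What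
  remains is a Hermitian block of smaller dimension.
\<close>

theorem hermitian_diagonalization:
  fixes A :: "complex mat"
  assumes "A \<in> carrier_mat n n" "mat_adjoint A = A"
  obtains U d where "U \<in> carrier_mat n n" "mat_adjoint U * U = 1\<^sub>m n" "U * mat_adjoint U = 1\<^sub>m n"
    "A = U * diag_of n d * mat_adjoint U"
proof -
  have "\<exists>U d. U \<in> carrier_mat n n \<and> mat_adjoint U * U = 1\<^sub>m n \<and> A = U * diag_of n d * mat_adjoint U"
    using assms
  proof (induction n arbitrary: A)
    case 0
    then show ?case
      by (intro exI[of _ "1\<^sub>m 0"] exI[of _ "\<lambda>_. 0"]) auto
  next
    case (Suc n)
    let ?N = "Suc n"
    note A = Suc.prems
    obtain v e where v: "v \<in> carrier_vec ?N" "v \<noteq> 0\<^sub>v ?N" "A *\<^sub>v v = e \<cdot>\<^sub>v v"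
      using exists_eigenvector[OF A(1)] by auto
    obtain U c where U: "U \<in> carrier_mat ?N ?N" "mat_adjoint U * U = 1\<^sub>m ?N" "col U 0 = c \<cdot>\<^sub>v v"
      using exists_unitary_first_column[OF v(1,2)] by blast
    have UU: "U * mat_adjoint U = 1\<^sub>m ?N"
      using mat_mult_left_right_inverse[OF mat_adjoint_carrier[OF U(1)] U(1,2)] .
    define B where "B = mat_adjoint U * (A * U)"
    have B: "B \<in> carrier_mat ?N ?N" using U A by (simp add: B_def)
    have Bherm: "mat_adjoint B = B"
      unfolding B_def using U A
      by (simp add: mat_adjoint_mult[of _ ?N ?N _ ?N] assoc_mult_mat[of _ ?N ?N _ ?N _ ?N])
    have colU: "col U 0 \<in> carrier_vec ?N"
      using U(1) by (metis carrier_vecI col_dim carrier_matD(1))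
    have "col B 0 = mat_adjoint U *\<^sub>v (A *\<^sub>v col U 0)"
      unfolding B_def using U A
      by (subst col_mult2[of _ ?N ?N _ ?N]) (auto intro!: arg_cong[of _ _ "\<lambda>x. mat_adjoint U *\<^sub>v x"] col_mult2[of _ ?N ?N _ ?N])
    also have "A *\<^sub>v col U 0 = e \<cdot>\<^sub>v col U 0"
      using U(3) v A by (simp add: mult_mat_vec[of _ ?N ?N] smult_smult_assoc mult.commute)
    also have "mat_adjoint U *\<^sub>v (e \<cdot>\<^sub>v col U 0) = e \<cdot>\<^sub>v col (mat_adjoint U * U) 0"
      using U(1) colU by (simp add: mult_mat_vec[of _ ?N ?N] col_mult2[of _ ?N ?N _ ?N])
    finally have col: "col B 0 = e \<cdot>\<^sub>v unit_vec ?N 0"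
      using U(2) by simp
    have B0: "B $$ (i, 0) = (if i = 0 then e else 0)" if "i < ?N" for i
      using arg_cong[OF col, of "\<lambda>x. x $ i"] that B by auto
    have B0': "B $$ (0, i) = (if i = 0 then cnj e else 0)" if "i < ?N" for i
      using B0[OF that] mat_adjoint_index[of 0 B i] B that unfolding Bherm by auto
    \<comment> \<open>The eigenvalue is a diagonal entry of a Hermitian matrix.\<close>
    have e: "e = complex_of_real (Re e)"
      using B0[of 0] B0'[of 0] by (simp add: complex_eq_iff)
    define A3 where "A3 = mat n n (\<lambda>(i, j). B $$ (Suc i, Suc j))"
    have A3: "A3 \<in> carrier_mat n n" by (simp add: A3_def)
    have "mat_adjoint A3 = A3"
    proof (rule eq_matI)
      fix i j assume "i < dim_row A3" "j < dim_col A3"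
      then have "i < n" "j < n" using A3 by auto
      then show "mat_adjoint A3 $$ (i, j) = A3 $$ (i, j)"
        using mat_adjoint_index[of "Suc i" B "Suc j"] B unfolding Bherm by (simp add: A3_def)
    qed (use A3 in auto)
    then obtain V d where V: "V \<in> carrier_mat n n" "mat_adjoint V * V = 1\<^sub>m n"
        "A3 = V * diag_of n d * mat_adjoint V"
      using Suc.IH[OF A3] by blast
    let ?blk = "\<lambda>a M. four_block_mat a (0\<^sub>m 1 n) (0\<^sub>m n 1) M"
    define W where "W = ?blk (1\<^sub>m 1) V"
    define f where "f = case_nat (Re e) d"
    have Wc: "W \<in> carrier_mat ?N ?N"
      unfolding W_def using four_block_carrier_mat[of "1\<^sub>m 1" 1 1 V n n] V by simp
    have blk1: "?blk (1\<^sub>m 1) (1\<^sub>m n) = (1\<^sub>m ?N :: complex mat)"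
      by (intro eq_matI) auto
    have diag: "diag_of ?N f = ?blk (diag_of 1 (\<lambda>_. Re e)) (diag_of n d)"
      by (intro eq_matI) (auto simp: diag_of_def f_def four_block_mat_def Let_def split: nat.splits)
    have B_blk: "B = ?blk (diag_of 1 (\<lambda>_. Re e)) A3"
    proof (rule eq_matI)
      fix i j assume "i < dim_row (?blk (diag_of 1 (\<lambda>_. Re e)) A3)"
        "j < dim_col (?blk (diag_of 1 (\<lambda>_. Re e)) A3)"
      then have "i < ?N" "j < ?N" using A3 by (auto simp: diag_of_def)
      then show "B $$ (i, j) = ?blk (diag_of 1 (\<lambda>_. Re e)) A3 $$ (i, j)"
        using B0[of i] B0'[of j] e by (auto simp: four_block_mat_def Let_def A3_def diag_of_def)
    qed (use B A3 in \<open>auto simp: diag_of_def\<close>)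
    have Wadj: "mat_adjoint W = ?blk (1\<^sub>m 1) (mat_adjoint V)"
      unfolding W_def by (rule mat_adjoint_four_block_diag[OF V(1)])
    have WW: "mat_adjoint W * W = 1\<^sub>m ?N"
      unfolding Wadj unfolding W_def using V blk1 by (simp add: mult_four_block_diag del: One_nat_def)
    have BW: "B = W * diag_of ?N f * mat_adjoint W"
      unfolding Wadj unfolding W_def diag B_blk V(3) using V(1)
      by (simp add: mult_four_block_diag left_mult_one_mat[OF diag_of_carrier] right_mult_one_mat[OF diag_of_carrier]
          del: One_nat_def)
    have "A = (U * mat_adjoint U) * A * (U * mat_adjoint U)"
      using UU A by simp
    also have "\<dots> = U * B * mat_adjoint U"
      unfolding B_def using A U by (simp add: assoc_mult_mat[of _ ?N ?N _ ?N _ ?N])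
    also have "\<dots> = (U * W) * diag_of ?N f * mat_adjoint (U * W)"
      unfolding BW using U Wc by (simp add: assoc_mult_mat[of _ ?N ?N _ ?N _ ?N] mat_adjoint_mult[of _ ?N ?N _ ?N])
    finally have Aeq: "A = (U * W) * diag_of ?N f * mat_adjoint (U * W)" .
    have "mat_adjoint (U * W) * (U * W) = mat_adjoint W * ((mat_adjoint U * U) * W)"
      using U(1) Wc by (simp add: assoc_mult_mat[of _ ?N ?N _ ?N _ ?N] mat_adjoint_mult[of _ ?N ?N _ ?N])
    also have "\<dots> = 1\<^sub>m ?N"
      unfolding U(2) using WW Wc by simp
    finally show ?case
      using Aeq U Wc by (intro exI[of _ "U * W"] exI[of _ f]) simp
  qed
  then obtain U d where U: "U \<in> carrier_mat n n" "mat_adjoint U * U = 1\<^sub>m n"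
      "A = U * diag_of n d * mat_adjoint U"
    by blast
  moreover have "U * mat_adjoint U = 1\<^sub>m n"
    using mat_mult_left_right_inverse[OF mat_adjoint_carrier[OF U(1)] U(1,2)] .
  ultimately show thesis
    using that by blast
qed

section \<open>Positive definite and semidefinite matrices\<close>

definition qform :: "complex mat \<Rightarrow> complex vec \<Rightarrow> complex" where
  "qform M v = (M *\<^sub>v v) \<bullet>c v"

definition hermitian :: "nat \<Rightarrow> complex mat set" where
  "hermitian n = {M \<in> carrier_mat n n. mat_adjoint M = M}"

definition psd :: "nat \<Rightarrow> complex mat set" where
  "psd n = {M \<in> hermitian n. \<forall>v \<in> carrier_vec n. 0 \<le> qform M v}"

definition pd :: "nat \<Rightarrow> complex mat set" where
  "pd n = {M \<in> hermitian n. \<forall>v \<in> carrier_vec n. v \<noteq> 0\<^sub>v n \<longrightarrow> 0 < qform M v}"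

lemma hermitianD: "M \<in> hermitian n \<Longrightarrow> M \<in> carrier_mat n n" "M \<in> hermitian n \<Longrightarrow> mat_adjoint M = M"
  by (auto simp: hermitian_def)

lemma psdD: "M \<in> psd n \<Longrightarrow> M \<in> carrier_mat n n" "M \<in> psd n \<Longrightarrow> mat_adjoint M = M"
  "M \<in> psd n \<Longrightarrow> v \<in> carrier_vec n \<Longrightarrow> 0 \<le> qform M v"
  by (auto simp: psd_def hermitian_def)

lemma pdD: "M \<in> pd n \<Longrightarrow> M \<in> carrier_mat n n" "M \<in> pd n \<Longrightarrow> mat_adjoint M = M"
  "M \<in> pd n \<Longrightarrow> v \<in> carrier_vec n \<Longrightarrow> v \<noteq> 0\<^sub>v n \<Longrightarrow> 0 < qform M v"
  by (auto simp: pd_def hermitian_def)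

lemma pd_hermitian: "M \<in> pd n \<Longrightarrow> M \<in> hermitian n"
  by (simp add: pd_def)

lemma pd_imp_psd: "M \<in> pd n \<Longrightarrow> M \<in> psd n"
proof -
  have "qform M (0\<^sub>v n) = 0" if "M \<in> carrier_mat n n"
    using that by (auto simp: qform_def scalar_prod_def)
  then show "M \<in> pd n \<Longrightarrow> M \<in> psd n"
    unfolding pd_def psd_def hermitian_def by (force simp: less_le)
qed

lemma qform_add:
  assumes "M \<in> carrier_mat n n" "K \<in> carrier_mat n n" "v \<in> carrier_vec n"
  shows "qform (M + K) v = qform M v + qform K v"
  using assms unfolding qform_def
  by (simp add: add_mult_distrib_mat_vec[of _ n n] add_scalar_prod_distrib[of _ n])

lemma qform_minus:
  assumes "M \<in> carrier_mat n n" "K \<in> carrier_mat n n" "v \<in> carrier_vec n"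
  shows "qform (M - K) v = qform M v - qform K v"
  using assms unfolding qform_def
  by (simp add: minus_mult_distrib_mat_vec[of _ n n] minus_scalar_prod_distrib[of _ n])

lemma qform_smult:
  assumes "M \<in> carrier_mat n n" "v \<in> carrier_vec n"
  shows "qform (c \<cdot>\<^sub>m M) v = c * qform M v"
proof -
  have "(c \<cdot>\<^sub>m M) *\<^sub>v v = c \<cdot>\<^sub>v (M *\<^sub>v v)"
    using assms by (intro eq_vecI) auto
  then show ?thesis
    using assms by (simp add: qform_def smult_scalar_prod_distrib[of _ n])
qed

lemma mult_mat_zero_vec [simp]: "A \<in> carrier_mat m n \<Longrightarrow> A *\<^sub>v 0\<^sub>v n = (0\<^sub>v m :: complex vec)"
  by (intro eq_vecI) auto

lemma qform_congruence:
  assumes "M \<in> carrier_mat n n" "C \<in> carrier_mat n n" "v \<in> carrier_vec n"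
  shows "qform (mat_adjoint C * M * C) v = qform M (C *\<^sub>v v)"
proof -
  have "qform (mat_adjoint C * M * C) v = (mat_adjoint C *\<^sub>v (M *\<^sub>v (C *\<^sub>v v))) \<bullet>c v"
    using assms by (simp add: qform_def assoc_mult_mat_vec[of _ n n _ n])
  also have "\<dots> = (M *\<^sub>v (C *\<^sub>v v)) \<bullet>c (C *\<^sub>v v)"
    using assms by (subst inner_adjoint[of _ n n]) auto
  finally show ?thesis by (simp add: qform_def)
qed

lemma qform_square:
  assumes "M \<in> hermitian n" "v \<in> carrier_vec n"
  shows "qform (M * M) v = (M *\<^sub>v v) \<bullet>c (M *\<^sub>v v)"
  using assms unfolding hermitian_def qform_def
  by (auto simp: inner_adjoint[of M n n])

lemma hermitian_congruence:
  assumes "M \<in> hermitian n" "C \<in> carrier_mat n n"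
  shows "mat_adjoint C * M * C \<in> hermitian n"
  using assms unfolding hermitian_def
  by (auto simp: mat_adjoint_mult[of _ n n _ n] assoc_mult_mat[of _ n n _ n _ n])

lemma psd_congruence:
  assumes "M \<in> psd n" "C \<in> carrier_mat n n"
  shows "mat_adjoint C * M * C \<in> psd n"
  using assms hermitian_congruence[of M n C] qform_congruence[of M n C]
  by (auto simp: psd_def hermitian_def)

text \<open>
  The quadratic form of \<open>C\<^sup>H M C\<close> at \<open>v\<close> is that of \<open>M\<close> at \<open>C v\<close>. A left inverse of \<open>C\<close> keeps \<open>C v\<close>
  away from zero.
\<close>

lemma pd_congruence:
  assumes M: "M \<in> pd n" and C: "C \<in> carrier_mat n n" and R: "R \<in> carrier_mat n n" "R * C = 1\<^sub>m n"
  shows "mat_adjoint C * M * C \<in> pd n"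
proof -
  have "C *\<^sub>v v \<noteq> 0\<^sub>v n" if v: "v \<in> carrier_vec n" "v \<noteq> 0\<^sub>v n" for v
  proof
    assume "C *\<^sub>v v = 0\<^sub>v n"
    then have "(R * C) *\<^sub>v v = 0\<^sub>v n"
      using R(1) C v by (simp add: assoc_mult_mat_vec[of _ n n _ n])
    then show False using R v by simp
  qed
  then show ?thesis
    using assms hermitian_congruence[of M n C] qform_congruence[of M n C]
    by (auto simp: pd_def hermitian_def)
qed

lemma psd_sandwich: "M \<in> psd n \<Longrightarrow> C \<in> hermitian n \<Longrightarrow> C * M * C \<in> psd n"
  using psd_congruence[of M n C] by (simp add: hermitian_def)

lemma pd_sandwich:
  "M \<in> pd n \<Longrightarrow> C \<in> hermitian n \<Longrightarrow> R \<in> carrier_mat n n \<Longrightarrow> R * C = 1\<^sub>m n \<Longrightarrow> C * M * C \<in> pd n"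
  using pd_congruence[of M n C R] by (simp add: hermitian_def)

lemma hermitian_add: "M \<in> hermitian n \<Longrightarrow> K \<in> hermitian n \<Longrightarrow> M + K \<in> hermitian n"
  by (auto simp: hermitian_def mat_adjoint_add[of _ n n])

lemma hermitian_minus: "M \<in> hermitian n \<Longrightarrow> K \<in> hermitian n \<Longrightarrow> M - K \<in> hermitian n"
  by (auto simp: hermitian_def mat_adjoint_minus[of _ n n])

lemma psd_add: "M \<in> psd n \<Longrightarrow> K \<in> psd n \<Longrightarrow> M + K \<in> psd n"
  by (auto simp: psd_def hermitian_add) (auto simp: hermitian_def qform_add[of _ n])

lemma pd_add_psd: "M \<in> pd n \<Longrightarrow> K \<in> psd n \<Longrightarrow> M + K \<in> pd n"
  by (auto simp: psd_def pd_def hermitian_add)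
    (auto simp: hermitian_def qform_add[of _ n] intro: add_pos_nonneg)

lemma smult_real_hermitian:
  "M \<in> hermitian n \<Longrightarrow> complex_of_real c \<cdot>\<^sub>m M \<in> hermitian n"
  by (auto simp: hermitian_def mat_adjoint_smult)

lemma smult_psd: "M \<in> psd n \<Longrightarrow> 0 \<le> c \<Longrightarrow> complex_of_real c \<cdot>\<^sub>m M \<in> psd n"
  by (auto simp: psd_def smult_real_hermitian)
    (auto simp: hermitian_def qform_smult[of _ n] less_eq_complex_def)

lemma smult_pd: "M \<in> pd n \<Longrightarrow> 0 < c \<Longrightarrow> complex_of_real c \<cdot>\<^sub>m M \<in> pd n"
  by (auto simp: pd_def smult_real_hermitian)
    (auto simp: hermitian_def qform_smult[of _ n] less_complex_def)

section \<open>Square roots and their order\<close>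

lemma qform_diag_of:
  assumes "v \<in> carrier_vec n"
  shows "qform (diag_of n d) v = complex_of_real (\<Sum>i<n. d i * (cmod (v $ i))\<^sup>2)"
proof -
  have "qform (diag_of n d) v = (\<Sum>i<n. (diag_of n d *\<^sub>v v) $ i * cnj (v $ i))"
    using assms by (simp add: qform_def scalar_prod_def atLeast0LessThan)
  also have "\<dots> = (\<Sum>i<n. complex_of_real (d i * (cmod (v $ i))\<^sup>2))"
    using assms by (intro sum.cong) (simp_all add: diag_of_mult_vec mult.assoc complex_norm_square[symmetric])
  finally show ?thesis by simp
qed

lemma diag_of_psd: "(\<And>i. i < n \<Longrightarrow> 0 \<le> d i) \<Longrightarrow> diag_of n d \<in> psd n"
  by (auto simp: psd_def hermitian_def qform_diag_of less_eq_complex_def intro!: sum_nonneg)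

lemma diag_of_pd:
  assumes "\<And>i. i < n \<Longrightarrow> 0 < d i"
  shows "diag_of n d \<in> pd n"
proof -
  have "0 < qform (diag_of n d) v" if v: "v \<in> carrier_vec n" "v \<noteq> 0\<^sub>v n" for v
  proof -
    obtain i where i: "i < n" "v $ i \<noteq> 0"
      using v by (auto simp: vec_eq_iff)
    have "0 < (\<Sum>i<n. d i * (cmod (v $ i))\<^sup>2)"
      using i assms by (intro sum_pos2[of _ i]) (auto intro!: mult_nonneg_nonneg intro: less_imp_le)
    then show ?thesis
      using v by (simp add: qform_diag_of less_complex_def)
  qed
  then show ?thesis by (simp add: pd_def hermitian_def)
qed

lemma eigenvector_of_diagonalization:
  assumes U: "U \<in> carrier_mat n n" "mat_adjoint U * U = 1\<^sub>m n"
    and A: "A = U * diag_of n d * mat_adjoint U" and i: "i < n"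
  shows "col U i \<in> carrier_vec n" "col U i \<noteq> 0\<^sub>v n"
    "A *\<^sub>v col U i = complex_of_real (d i) \<cdot>\<^sub>v col U i"
proof -
  have U_unit: "col U i = U *\<^sub>v unit_vec n i"
    using U i by (auto intro!: eq_vecI)
  show c: "col U i \<in> carrier_vec n"
    unfolding U_unit using U by simp
  have adj: "mat_adjoint U *\<^sub>v col U i = unit_vec n i"
    unfolding U_unit using U by (simp flip: assoc_mult_mat_vec[of _ n n _ n])
  show "col U i \<noteq> 0\<^sub>v n"
  proof
    assume "col U i = 0\<^sub>v n"
    then have "mat_adjoint U *\<^sub>v col U i = 0\<^sub>v n"
      using U by auto
    then have "unit_vec n i $ i = (0 :: complex)"
      unfolding adj using i by simp
    then show False using i by simp
  qed
  have "A *\<^sub>v col U i = U *\<^sub>v (diag_of n d *\<^sub>v (mat_adjoint U *\<^sub>v col U i))"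
    unfolding A using U c
    by (simp add: assoc_mult_mat_vec[of _ n n _ n] assoc_mult_mat[of _ n n _ n _ n])
  also have "diag_of n d *\<^sub>v (mat_adjoint U *\<^sub>v col U i) = complex_of_real (d i) \<cdot>\<^sub>v unit_vec n i"
    unfolding adj
  proof (rule eq_vecI)
    fix j assume "j < dim_vec (complex_of_real (d i) \<cdot>\<^sub>v unit_vec n i)"
    then show "(diag_of n d *\<^sub>v unit_vec n i) $ j = (complex_of_real (d i) \<cdot>\<^sub>v unit_vec n i) $ j"
      using i by (auto simp: diag_of_mult_vec)
  qed (simp add: diag_of_def)
  also have "U *\<^sub>v (complex_of_real (d i) \<cdot>\<^sub>v unit_vec n i) = complex_of_real (d i) \<cdot>\<^sub>v col U i"
    unfolding U_unit using U by (simp add: mult_mat_vec[of _ n n])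
  finally show "A *\<^sub>v col U i = complex_of_real (d i) \<cdot>\<^sub>v col U i" .
qed

lemma qform_eigenvector:
  assumes "M *\<^sub>v v = c \<cdot>\<^sub>v v"
  shows "qform M v = c * (v \<bullet>c v)"
  using assms by (simp add: qform_def smult_scalar_prod_distrib[of _ "dim_vec v"])

text \<open>
  In a unitary basis of eigenvectors, the square root and the inverse are obtained by applying
  the functions \<open>sqrt\<close> and \<open>\<lambda>x. 1 / x\<close> to the eigenvalues, which are positive.
\<close>

lemma pd_square_root_and_inverse:
  assumes A: "A \<in> pd n"
  obtains S R where "S \<in> pd n" "S * S = A" "R \<in> pd n" "A * R = 1\<^sub>m n" "R * A = 1\<^sub>m n"
proof -
  obtain U d where U: "U \<in> carrier_mat n n" "mat_adjoint U * U = 1\<^sub>m n" "U * mat_adjoint U = 1\<^sub>m n"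
      and AU: "A = U * diag_of n d * mat_adjoint U"
    using hermitian_diagonalization[OF pdD(1,2)[OF A]] by blast
  have d: "0 < d i" if i: "i < n" for i
  proof -
    note ev = eigenvector_of_diagonalization[OF U(1,2) AU i]
    have "0 < complex_of_real (d i) * (col U i \<bullet>c col U i)"
      using pdD(3)[OF A ev(1,2)] unfolding qform_eigenvector[OF ev(3)] .
    moreover have "0 \<le> col U i \<bullet>c col U i" by (rule conjugate_square_ge_0_vec)
    ultimately show ?thesis
      by (auto simp: less_complex_def less_eq_complex_def zero_less_mult_iff)
  qed
  let ?f = "\<lambda>e. U * diag_of n e * mat_adjoint U"
  have pd: "?f e \<in> pd n" if "\<And>i. i < n \<Longrightarrow> 0 < e i" for e
    using pd_congruence[OF diag_of_pd[OF that] mat_adjoint_carrier[OF U(1)] U(1,3)] by simp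
  have mult: "?f e * ?f g = ?f (\<lambda>i. e i * g i)" for e g
  proof -
    have "?f e * ?f g = U * (diag_of n e * ((mat_adjoint U * U) * diag_of n g)) * mat_adjoint U"
      using U(1) by (simp add: assoc_mult_mat[of _ n n _ n _ n])
    then show ?thesis
      unfolding U(2) by (simp add: left_mult_one_mat[OF diag_of_carrier] diag_of_mult)
  qed
  have cong: "?f e = ?f g" if "\<And>i. i < n \<Longrightarrow> e i = g i" for e g
  proof -
    have "diag_of n e = diag_of n g"
      using that by (intro eq_matI) (auto simp: diag_of_def)
    then show ?thesis by simp
  qed
  have one: "?f (\<lambda>_. 1) = 1\<^sub>m n"
  proof -
    have "diag_of n (\<lambda>_. 1) = 1\<^sub>m n" by (intro eq_matI) (auto simp: diag_of_def)
    then show ?thesis using U by simp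
  qed
  show thesis
  proof (rule that[of "?f (\<lambda>i. sqrt (d i))" "?f (\<lambda>i. 1 / d i)"])
    show "?f (\<lambda>i. sqrt (d i)) * ?f (\<lambda>i. sqrt (d i)) = A"
      unfolding mult AU using d by (intro cong) (simp add: abs_of_pos)
    have "?f d * ?f (\<lambda>i. 1 / d i) = ?f (\<lambda>_. 1)"
      unfolding mult using d by (intro cong) force
    then show "A * ?f (\<lambda>i. 1 / d i) = 1\<^sub>m n"
      unfolding one AU .
    have "?f (\<lambda>i. 1 / d i) * ?f d = ?f (\<lambda>_. 1)"
      unfolding mult using d by (intro cong) force
    then show "?f (\<lambda>i. 1 / d i) * A = 1\<^sub>m n"
      unfolding one AU .
  qed (use d in \<open>auto intro!: pd\<close>)
qed

text \<open>
  The core of the Loewner-Heinz inequality. If \<open>S - C\<close> had a negative eigenvalue \<open>- e\<close> with eigenvector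
  \<open>v\<close>, then \<open>C v = S v + e v\<close>, hence
  \<open>\<parallel>C v\<parallel>\<^sup>2 = \<parallel>S v\<parallel>\<^sup>2 + 2 e \<langle>v, S v\<rangle> + e\<^sup>2 \<parallel>v\<parallel>\<^sup>2 > \<parallel>S v\<parallel>\<^sup>2\<close>, against \<open>C\<^sup>2 \<le> S\<^sup>2\<close>.
\<close>

lemma psd_diff_of_square_le:
  assumes S: "S \<in> pd n" and C: "C \<in> hermitian n" and le: "S * S - C * C \<in> psd n"
  shows "S - C \<in> psd n"
proof -
  have car: "S \<in> carrier_mat n n" "C \<in> carrier_mat n n"
    using pdD(1)[OF S] hermitianD(1)[OF C] .
  have herm: "S - C \<in> hermitian n"
    using pd_hermitian[OF S] C by (rule hermitian_minus)
  obtain U d where U: "U \<in> carrier_mat n n" "mat_adjoint U * U = 1\<^sub>m n" "U * mat_adjoint U = 1\<^sub>m n"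
      and SC: "S - C = U * diag_of n d * mat_adjoint U"
    using hermitian_diagonalization[OF hermitianD[OF herm]] by blast
  have d: "0 \<le> d i" if i: "i < n" for i
  proof (rule ccontr)
    assume "\<not> 0 \<le> d i"
    then have neg: "d i < 0" by simp
    define v where "v = col U i"
    define e where "e = complex_of_real (- d i)"
    note ev = eigenvector_of_diagonalization[OF U(1,2) SC i, folded v_def]
    define w where "w = S *\<^sub>v v"
    have w: "w \<in> carrier_vec n" using car ev(1) by (simp add: w_def)
    have "w - C *\<^sub>v v = complex_of_real (d i) \<cdot>\<^sub>v v"
      using ev(3) car ev(1) unfolding w_def by (simp add: minus_mult_distrib_mat_vec[of _ n n])
    then have eq: "w $ j - (C *\<^sub>v v) $ j = - e * v $ j" if "j < n" for j
    proof -
      have "w $ j - (C *\<^sub>v v) $ j = (w - C *\<^sub>v v) $ j"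
        using that car by simp
      also have "\<dots> = - e * v $ j"
        unfolding \<open>w - C *\<^sub>v v = _\<close> using that ev(1) by (simp add: e_def)
      finally show ?thesis .
    qed
    have Cv: "C *\<^sub>v v = w + e \<cdot>\<^sub>v v"
    proof (rule eq_vecI)
      fix j assume "j < dim_vec (w + e \<cdot>\<^sub>v v)"
      then have "j < n" using ev(1) by simp
      then show "(C *\<^sub>v v) $ j = (w + e \<cdot>\<^sub>v v) $ j"
        using eq[of j] ev(1) w car by (simp add: algebra_simps del: index_mult_mat_vec)
    qed (use car ev(1) in simp)
    have vw: "v \<bullet>c w = w \<bullet>c v"
      using inner_adjoint[OF car(1) ev(1) ev(1)] pdD(2)[OF S] by (simp add: w_def)
    have "qform (C * C) v = (w + e \<cdot>\<^sub>v v) \<bullet>c (w + e \<cdot>\<^sub>v v)"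
      using qform_square[OF C ev(1)] Cv by simp
    also have "\<dots> = w \<bullet>c w + e * (w \<bullet>c v) + e * (w \<bullet>c v) + e * e * (v \<bullet>c v)"
      using w ev(1) vw
      by (simp add: conjugate_add_vec[of _ n] conjugate_smult_vec add_scalar_prod_distrib[of _ n]
          scalar_prod_add_distrib[of _ n] e_def algebra_simps)
    also have "w \<bullet>c w = qform (S * S) v"
      using qform_square[OF pd_hermitian[OF S] ev(1)] by (simp add: w_def)
    finally have "qform (S * S - C * C) v = - (e * (w \<bullet>c v) + e * (w \<bullet>c v) + e * e * (v \<bullet>c v))"
      using car ev(1) by (simp add: qform_minus[of _ n])
    moreover have "0 < w \<bullet>c v"
      using pdD(3)[OF S ev(1,2)] by (simp add: qform_def w_def)
    then have "0 < e * (w \<bullet>c v)"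
      using neg by (simp add: e_def less_complex_def mult_neg_pos)
    moreover have "0 \<le> e * e * (v \<bullet>c v)"
      using conjugate_square_ge_0_vec[of v] by (auto simp: e_def less_eq_complex_def)
    moreover have "0 \<le> qform (S * S - C * C) v"
      using psdD(3)[OF le ev(1)] .
    ultimately show False
      by (simp add: less_complex_def less_eq_complex_def)
  qed
  show ?thesis
    using psd_congruence[OF diag_of_psd[OF d] mat_adjoint_carrier[OF U(1)]] by (simp add: SC)
qed

lemma psd_antisym:
  assumes car: "M \<in> carrier_mat n n" "N \<in> carrier_mat n n"
    and MN: "M - N \<in> psd n" and NM: "N - M \<in> psd n"
  shows "M = N"
proof -
  obtain U d where U: "U \<in> carrier_mat n n" "mat_adjoint U * U = 1\<^sub>m n" "U * mat_adjoint U = 1\<^sub>m n"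
      and DU: "M - N = U * diag_of n d * mat_adjoint U"
    using hermitian_diagonalization[OF psdD(1,2)[OF MN]] by blast
  have "d i = 0" if i: "i < n" for i
  proof -
    note ev = eigenvector_of_diagonalization[OF U(1,2) DU i]
    have "0 < col U i \<bullet>c col U i"
      using ev by simp
    moreover have "qform (M - N) (col U i) = 0"
      using psdD(3)[OF MN ev(1)] psdD(3)[OF NM ev(1)] car ev(1) by (simp add: qform_minus[of _ n])
    then have "complex_of_real (d i) * (col U i \<bullet>c col U i) = 0"
      unfolding qform_eigenvector[OF ev(3)] .
    ultimately show ?thesis
      by auto
  qed
  then have "diag_of n d = 0\<^sub>m n n"
    by (intro eq_matI) (auto simp: diag_of_def)
  then have z: "M - N = 0\<^sub>m n n" using U(1) by (simp add: DU)
  show ?thesis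
  proof (rule eq_matI)
    fix i j assume "i < dim_row N" "j < dim_col N"
    then show "M $$ (i, j) = N $$ (i, j)"
      using arg_cong[OF z, of "\<lambda>D. D $$ (i, j)"] car by simp
  qed (use car in auto)
qed

text \<open>
  Two square roots have the same square, so the preceding inequality holds between them in both
  directions.
\<close>

lemma pd_square_root_unique:
  assumes S: "S \<in> pd n" and T: "T \<in> pd n" and eq: "S * S = T * T"
  shows "S = T"
proof -
  note car = pdD(1)[OF S] pdD(1)[OF T]
  have "0\<^sub>m n n \<in> psd n"
    by (auto simp: psd_def hermitian_def qform_def scalar_prod_def intro!: eq_matI)
  moreover have "S * S - T * T = 0\<^sub>m n n" "T * T - S * S = 0\<^sub>m n n"
    using car eq by auto
  ultimately have "S - T \<in> psd n" "T - S \<in> psd n"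
    using psd_diff_of_square_le[OF S pd_hermitian[OF T]] psd_diff_of_square_le[OF T pd_hermitian[OF S]]
    by auto
  then show ?thesis
    by (rule psd_antisym[OF car])
qed

section \<open>Inverses and geometric means of positive definite matrices\<close>

text \<open>
  Fixing all dimensions to be equal leaves the simplifier no intermediate dimension to guess when it
  proves the carrier premises.
\<close>

lemma square_assoc:
  assumes "A \<in> carrier_mat n n" "B \<in> carrier_mat n n" "C \<in> carrier_mat n n"
  shows "(A * B) * C = A * (B * C)"
  using assms by (rule assoc_mult_mat)

lemma square_diff_distrib:
  fixes A B C :: "complex mat"
  assumes "A \<in> carrier_mat n n" "B \<in> carrier_mat n n" "C \<in> carrier_mat n n"
  shows "(A - B) * C = A * C - B * C" "C * (A - B) = C * A - C * B"
  using assms by (simp_all add: minus_mult_distrib_mat mult_minus_distrib_mat)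

lemma pd_inverse:
  assumes A: "A \<in> pd n" and R: "R \<in> carrier_mat n n" "A * R = 1\<^sub>m n"
  shows "R \<in> pd n" "R * A = 1\<^sub>m n"
proof -
  obtain S R' where R': "R' \<in> pd n" "R' * A = 1\<^sub>m n"
    using pd_square_root_and_inverse[OF A] by metis
  have "R' = R' * (A * R)"
    using R R' pdD(1)[OF R'(1)] by simp
  also have "\<dots> = (R' * A) * R"
    using R(1) pdD(1)[OF R'(1)] pdD(1)[OF A] by (simp add: square_assoc[of _ n])
  also have "\<dots> = R" using R R' by simp
  finally show "R \<in> pd n" "R * A = 1\<^sub>m n" using R' by auto
qed

lemma mult_inverse_cancel:
  assumes "A \<in> carrier_mat n n" "R \<in> carrier_mat n n" "A * R = (1\<^sub>m n :: complex mat)" "X \<in> carrier_mat n n"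
  shows "A * (R * X) = X"
  using assms by (metis assoc_mult_mat left_mult_one_mat)

text \<open>
  The identity behind the antitonicity of inversion. With \<open>D = B - A\<close> it writes the difference of the
  inverses as \<open>B' D B' + (D B')\<^sup>H A' (D B')\<close> when the matrices are Hermitian, that is, as a sum of congruence
  images of \<open>D\<close> and of \<open>A'\<close>. So no simultaneous diagonalization of \<open>A\<close> and \<open>B\<close> is needed.
\<close>

lemma inverse_difference:
  fixes A B A' B' :: "complex mat"
  assumes car: "A \<in> carrier_mat n n" "B \<in> carrier_mat n n" "A' \<in> carrier_mat n n" "B' \<in> carrier_mat n n"
    and inv: "A * A' = 1\<^sub>m n" "A' * A = 1\<^sub>m n" "B * B' = 1\<^sub>m n" "B' * B = 1\<^sub>m n"
  shows "A' - B' = B' * (B - A) * B' + (B' * (B - A)) * A' * ((B - A) * B')"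
proof -
  note c = mult_inverse_cancel[OF car(1,3) inv(1)] mult_inverse_cancel[OF car(3,1) inv(2)]
    mult_inverse_cancel[OF car(2,4) inv(3)] mult_inverse_cancel[OF car(4,2) inv(4)]
  have 1: "B' * (B - A) = 1\<^sub>m n - B' * A"
    using car inv by (simp add: square_diff_distrib[of _ n])
  have 2: "(B - A) * B' = 1\<^sub>m n - A * B'"
    using car inv by (simp add: square_diff_distrib[of _ n])
  have 3: "B' * (B - A) * B' = B' - B' * (A * B')"
    unfolding 1 using car
    by (simp add: square_diff_distrib[of _ n] square_assoc[of _ n])
  have 4: "(1\<^sub>m n - B' * A) * A' = A' - B'"
    using car inv by (simp add: square_diff_distrib[of _ n] square_assoc[of _ n])
  have 5: "(A' - B') * (1\<^sub>m n - A * B') = (A' - B') - (B' - B' * (A * B'))"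
    using car inv c
    by (simp add: square_diff_distrib[of _ n] square_assoc[of _ n])
  show ?thesis
    unfolding 3 unfolding 1 2 4 5 using car
    by (intro eq_matI) (auto simp del: index_mult_mat(1))
qed

lemma
  assumes A: "A \<in> pd n" and B: "B \<in> pd n"
    and A': "A' \<in> carrier_mat n n" "A * A' = 1\<^sub>m n" and B': "B' \<in> carrier_mat n n" "B * B' = 1\<^sub>m n"
  shows psd_inverse_antitone: "B - A \<in> psd n \<Longrightarrow> A' - B' \<in> psd n"
    and pd_inverse_antitone: "B - A \<in> pd n \<Longrightarrow> A' - B' \<in> pd n"
proof -
  note iA = pd_inverse[OF A A'] and iB = pd_inverse[OF B B']
  note eq = inverse_difference[OF pdD(1)[OF A] pdD(1)[OF B] A'(1) B'(1) A'(2) iA(2) B'(2) iB(2)]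
  have D: "B - A \<in> hermitian n"
    using A B by (intro hermitian_minus pd_hermitian)
  have "mat_adjoint ((B - A) * B') = B' * (B - A)"
    using hermitianD[OF D] pdD(1,2)[OF iB(1)] by (simp add: mat_adjoint_mult[of _ n n _ n])
  then have sq: "B' * (B - A) * A' * ((B - A) * B') \<in> psd n"
    using psd_congruence[OF pd_imp_psd[OF iA(1)], of "(B - A) * B'"] hermitianD(1)[OF D] B'(1) by simp
  show "A' - B' \<in> psd n" if "B - A \<in> psd n"
    unfolding eq using psd_sandwich[OF that pd_hermitian[OF iB(1)]] sq by (rule psd_add)
  show "A' - B' \<in> pd n" if "B - A \<in> pd n"
    unfolding eq using pd_sandwich[OF that pd_hermitian[OF iB(1)] pdD(1)[OF B] B'(2)] sq by (rule pd_add_psd)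
qed

text \<open>
  With \<open>R\<close> the square root of \<open>Q\<close>, multiplying by \<open>R\<close> from both sides turns \<open>X Q X \<le> G Q G\<close> into
  \<open>(R X R)\<^sup>2 \<le> (R G R)\<^sup>2\<close>, to which the inequality for square roots applies. It follows that the solution \<open>G\<close> of the
  Riccati equation \<open>G Q G = B\<close> is the largest Hermitian \<open>X\<close> with \<open>X Q X \<le> B\<close>.
\<close>

lemma riccati_solution_maximal:
  assumes Q: "Q \<in> pd n" and G: "G \<in> pd n" and X: "X \<in> hermitian n"
    and le: "G * Q * G - X * Q * X \<in> psd n"
  shows "G - X \<in> psd n"
proof -
  obtain R where R: "R \<in> pd n" "R * R = Q"
    using pd_square_root_and_inverse[OF Q] by metis
  obtain K where K: "K \<in> pd n" "R * K = 1\<^sub>m n" "K * R = 1\<^sub>m n"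
    using pd_square_root_and_inverse[OF R(1)] by metis
  note car = pdD(1)[OF Q] pdD(1)[OF G] hermitianD(1)[OF X] pdD(1)[OF R(1)] pdD(1)[OF K(1)]
  have sq: "R * (Y * Q * Y) * R = (R * Y * R) * (R * Y * R)" if "Y \<in> carrier_mat n n" for Y
    using car that by (simp add: R(2)[symmetric] square_assoc[of _ n])
  have diff: "R * (Y - Z) * R = R * Y * R - R * Z * R" if "Y \<in> carrier_mat n n" "Z \<in> carrier_mat n n" for Y Z
    using car that
    by (simp add: square_diff_distrib[of _ n])
  have "R * (G * Q * G - X * Q * X) * R = R * (G * Q * G) * R - R * (X * Q * X) * R"
    using car by (intro diff) simp_all
  also have "\<dots> = (R * G * R) * (R * G * R) - (R * X * R) * (R * X * R)"
    unfolding sq[OF car(2)] sq[OF car(3)] ..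
  finally have "(R * G * R) * (R * G * R) - (R * X * R) * (R * X * R) \<in> psd n"
    using psd_sandwich[OF le pd_hermitian[OF R(1)]] by simp
  moreover have "R * G * R \<in> pd n"
    using pd_sandwich[OF G pd_hermitian[OF R(1)] car(5) K(3)] .
  moreover have "R * X * R \<in> hermitian n"
    using hermitian_congruence[OF X car(4)] pdD(2)[OF R(1)] by simp
  ultimately have "R * G * R - R * X * R \<in> psd n"
    using psd_diff_of_square_le by blast
  then have "K * (R * (G - X) * R) * K \<in> psd n"
    using psd_sandwich[OF _ pd_hermitian[OF K(1)]] car by (simp add: diff)
  moreover have "K * (R * (G - X) * R) * K = G - X"
    using car K mult_inverse_cancel[OF car(5,4) K(3)] by (simp add: square_assoc[of _ n])
  ultimately show ?thesis by simp
qed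

text \<open>
  The geometric mean of \<open>A\<close> and \<open>B\<close> is a positive definite solution \<open>G\<close> of \<open>G A\<^sup>-\<^sup>1 G = B\<close>. All inequalities
  for the geometric mean are derived from this equation alone, without the square roots that define
  it.
\<close>

lemma geometric_mean_riccati:
  assumes A: "A \<in> pd n" and S: "S \<in> pd n" "S * S = A" and R: "R \<in> carrier_mat n n" "S * R = 1\<^sub>m n"
    and A': "A' \<in> carrier_mat n n" "A * A' = 1\<^sub>m n"
    and B: "B \<in> carrier_mat n n" and T: "T \<in> pd n" "T * T = R * B * R"
  shows "S * T * S \<in> pd n" "(S * T * S) * A' * (S * T * S) = B"
proof -
  note car = pdD(1)[OF A] pdD(1)[OF S(1)] R(1) A'(1) B pdD(1)[OF T(1)]
  note RS = pd_inverse[OF S(1) R]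
  note c = mult_inverse_cancel[OF car(2,3) R(2)] mult_inverse_cancel[OF car(3,2) RS(2)]
  show "S * T * S \<in> pd n"
    using pd_sandwich[OF T(1) pd_hermitian[OF S(1)] car(3) RS(2)] .
  have "A' = A' * (S * (S * R) * R)"
    using car R by simp
  also have "\<dots> = (A' * A) * (R * R)"
    using car by (simp add: S(2)[symmetric] square_assoc[of _ n])
  also have "\<dots> = R * R"
    using pd_inverse(2)[OF A A'] car by simp
  finally have A'R: "A' = R * R" .
  have "(S * T * S) * A' * (S * T * S) = S * (T * T) * S"
    using car c by (simp add: A'R square_assoc[of _ n])
  also have "\<dots> = B"
    using car c RS(2) by (simp add: T(2) square_assoc[of _ n])
  finally show "(S * T * S) * A' * (S * T * S) = B" .
qed

text \<open>
  If \<open>G A' G = B\<close>, then \<open>A + B - 2 G\<close> is the perfect square \<open>(A - G) A' (A - G)\<close>.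
\<close>

lemma arithmetic_geometric_mean_mat:
  assumes A: "A \<in> pd n" and A': "A' \<in> carrier_mat n n" "A * A' = 1\<^sub>m n"
    and G: "G \<in> hermitian n" "G * A' * G = B"
  shows "(1 / 2) \<cdot>\<^sub>m (A + B) - G \<in> psd n"
proof -
  note iA = pd_inverse[OF A A']
  note car = pdD(1)[OF A] A'(1) hermitianD(1)[OF G(1)]
  have B: "B \<in> carrier_mat n n" using car G(2) by auto
  have "(A - G) * A' * (A - G) = (A - G) - (G - G * (A' * G))"
    using car A'(2) iA(2) mult_inverse_cancel[OF car(1,2) A'(2)]
    by (simp add: square_diff_distrib[of _ n] square_assoc[of _ n])
  also have "G * (A' * G) = B"
    using G(2) car by (simp add: square_assoc[of _ n])
  finally have eq: "(A - G) * A' * (A - G) = (A - G) - (G - B)" .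
  have "complex_of_real (1 / 2) \<cdot>\<^sub>m ((A - G) * A' * (A - G)) \<in> psd n"
    using pd_hermitian[OF A] G(1) pd_imp_psd[OF iA(1)]
    by (intro smult_psd psd_sandwich hermitian_minus) auto
  moreover have "complex_of_real (1 / 2) \<cdot>\<^sub>m ((A - G) * A' * (A - G)) = (1 / 2) \<cdot>\<^sub>m (A + B) - G"
    unfolding eq using car B by (intro eq_matI) (auto simp: field_simps)
  ultimately show ?thesis by simp
qed

text \<open>
  Inverting the Riccati equation shows that the inverse of \<open>G\<close> solves the Riccati equation for the
  inverses of \<open>A\<close> and \<open>B\<close>. So the arithmetic-geometric mean inequality applies to them, and inverting
  both of its sides gives the harmonic one.
\<close>

lemma harmonic_geometric_mean_mat:
  assumes A: "A \<in> pd n" "A' \<in> carrier_mat n n" "A * A' = 1\<^sub>m n"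
    and B: "B \<in> pd n" "B' \<in> carrier_mat n n" "B * B' = 1\<^sub>m n"
    and H: "H \<in> carrier_mat n n" "(A' + B') * H = 1\<^sub>m n"
    and G: "G \<in> pd n" "G * A' * G = B"
  shows "G - 2 \<cdot>\<^sub>m H \<in> psd n"
proof -
  note iA = pd_inverse[OF A] and iB = pd_inverse[OF B]
  obtain K where K: "K \<in> pd n" "G * K = 1\<^sub>m n" "K * G = 1\<^sub>m n"
    using pd_square_root_and_inverse[OF G(1)] by metis
  note car = pdD(1)[OF A(1)] A(2) pdD(1)[OF B(1)] B(2) pdD(1)[OF G(1)] pdD(1)[OF K(1)] H(1)
  have "(K * A * K) * B = K * (A * (K * (G * A' * G)))"
    using car G(2) by (simp add: square_assoc[of _ n])
  also have "\<dots> = 1\<^sub>m n"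
    using car K(3) mult_inverse_cancel[OF car(6,5) K(3)] mult_inverse_cancel[OF car(1,2) A(3)]
    by (simp add: square_assoc[of _ n])
  finally have "(K * A * K) * B = 1\<^sub>m n" .
  then have "K * A * K = (K * A * K) * (B * B')"
    using B(3) car by simp
  also have "\<dots> = ((K * A * K) * B) * B'"
    using car by (simp add: square_assoc[of _ n])
  also have "\<dots> = B'"
    using \<open>(K * A * K) * B = 1\<^sub>m n\<close> car by simp
  finally have ric: "K * A * K = B'" .
  have mean: "(1 / 2) \<cdot>\<^sub>m (A' + B') - K \<in> psd n"
    using arithmetic_geometric_mean_mat[OF iA(1) car(1) iA(2) pd_hermitian[OF K(1)] ric] .
  have "complex_of_real (1 / 2) \<cdot>\<^sub>m (A' + B') \<in> pd n"
    using iA(1) iB(1) by (intro smult_pd pd_add_psd pd_imp_psd) auto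
  then have pd: "(1 / 2) \<cdot>\<^sub>m (A' + B') \<in> pd n" by simp
  have inv: "(1 / 2) \<cdot>\<^sub>m (A' + B') * (2 \<cdot>\<^sub>m H) = 1\<^sub>m n"
  proof -
    have "(1 / 2) \<cdot>\<^sub>m (A' + B') * (2 \<cdot>\<^sub>m H) = 2 \<cdot>\<^sub>m ((1 / 2) \<cdot>\<^sub>m ((A' + B') * H))"
      using car by (simp add: mult_smult_distrib[of _ n n _ n] mult_smult_assoc_mat[of _ n n _ n])
    also have "\<dots> = 1\<^sub>m n"
      unfolding H(2) by (intro eq_matI) auto
    finally show ?thesis .
  qed
  show ?thesis
    using psd_inverse_antitone[OF K(1) pd car(5) K(3) _ inv mean] car by simp
qed

text \<open>
  Since \<open>A1 \<le> A\<close> reverses for the inverses, \<open>G1 A' G1 \<le> G1 A1' G1 = B1 \<le> B = G A' G\<close>, and \<open>G\<close> is the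
  largest Hermitian matrix with this property.
\<close>

lemma geometric_mean_mono_mat:
  assumes A: "A \<in> pd n" "A' \<in> carrier_mat n n" "A * A' = 1\<^sub>m n"
    and A1: "A1 \<in> pd n" "A1' \<in> carrier_mat n n" "A1 * A1' = 1\<^sub>m n"
    and G: "G \<in> pd n" "G * A' * G = B" and G1: "G1 \<in> pd n" "G1 * A1' * G1 = B1"
    and AA: "A - A1 \<in> psd n" and BB: "B - B1 \<in> psd n"
  shows "G - G1 \<in> psd n"
proof (rule riccati_solution_maximal)
  show "A' \<in> pd n" using pd_inverse[OF A] by simp
  show "G \<in> pd n" by fact
  show "G1 \<in> hermitian n" using pd_hermitian[OF G1(1)] .
  note car = A(2) A1(2) pdD(1)[OF G(1)] pdD(1)[OF G1(1)]
  have "A1' - A' \<in> psd n"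
    using psd_inverse_antitone[OF A1(1) A(1) A1(2,3) A(2,3) AA] .
  then have 1: "G1 * (A1' - A') * G1 \<in> psd n"
    using psd_sandwich pd_hermitian[OF G1(1)] by blast
  have "G1 * (A1' - A') * G1 = B1 - G1 * A' * G1"
    using car by (simp add: G1(2)[symmetric] square_diff_distrib[of _ n])
  moreover have "(B - B1) + (B1 - G1 * A' * G1) = B - G1 * A' * G1"
    using car by (intro eq_matI) (auto simp: G(2)[symmetric] G1(2)[symmetric] simp del: index_mult_mat(1))
  ultimately show "G * A' * G - G1 * A' * G1 \<in> psd n"
    using psd_add[OF BB 1] by (simp add: G(2))
qed

section \<open>Block circulant matrices of tensors\<close>

lemma tensor_carrier_nth: "A \<in> tensor_carrier m n p \<Longrightarrow> k < p \<Longrightarrow> A ! k \<in> carrier_mat m n"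
  by (simp add: tensor_carrier_def)

lemma tensor_carrier_length: "A \<in> tensor_carrier m n p \<Longrightarrow> length A = p"
  by (simp add: tensor_carrier_def)

lemma tensor_dims:
  assumes "A \<in> tensor_carrier m n p" "0 < p"
  shows "trows A = m" "tcols A = n" "tdepth A = p"
  using assms by (auto simp: tensor_carrier_def trows_def tcols_def tdepth_def)

lemma tensor_eqI:
  assumes "A \<in> tensor_carrier m n p" "B \<in> tensor_carrier m n p"
    and "\<And>k i j. k < p \<Longrightarrow> i < m \<Longrightarrow> j < n \<Longrightarrow> A ! k $$ (i, j) = B ! k $$ (i, j)"
  shows "A = B"
proof (rule nth_equalityI)
  show "length A = length B" using assms by (simp add: tensor_carrier_length)
  fix k assume "k < length A"
  then have k: "k < p" using assms by (simp add: tensor_carrier_length)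
  show "A ! k = B ! k"
    using assms(3)[OF k] tensor_carrier_nth[OF assms(1) k] tensor_carrier_nth[OF assms(2) k]
    by (intro eq_matI) auto
qed

lemma block_index_less:
  fixes k i m p :: nat
  assumes "k < p" "i < m"
  shows "k * m + i < m * p"
proof -
  have "k * m + i < Suc k * m" using assms by simp
  also have "\<dots> \<le> p * m" using assms by (intro mult_right_mono) auto
  finally show ?thesis by (simp add: mult.commute)
qed

lemma block_index_split:
  fixes r m p :: nat
  assumes "r < m * p"
  shows "r div m < p" "r mod m < m" "r = r div m * m + r mod m"
  using assms by (auto simp: less_mult_imp_div_less mult.commute intro!: mod_less_divisor gr0I)

text \<open>
  The entries of a block matrix are addressed by block and position within the block, as \<open>k * m + i\<close>.
\<close>

lemma mat_eq_blockI:
  assumes "M \<in> carrier_mat (m * p) (n * q)" "N \<in> carrier_mat (m * p) (n * q)"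
    and "\<And>k l i j. k < p \<Longrightarrow> l < q \<Longrightarrow> i < m \<Longrightarrow> j < n \<Longrightarrow>
      M $$ (k * m + i, l * n + j) = N $$ (k * m + i, l * n + j)"
  shows "M = N"
proof (rule eq_matI)
  fix r c assume "r < dim_row N" "c < dim_col N"
  then have "r < m * p" "c < n * q" using assms by auto
  then show "M $$ (r, c) = N $$ (r, c)"
    using assms(3)[of "r div m" "c div n" "r mod m" "c mod n"] block_index_split[of r m p] block_index_split[of c n q]
    by simp
qed (use assms in auto)

lemma sum_blocks: "(\<Sum>r<m * p. f r) = (\<Sum>k<p. \<Sum>i<m. f (k * m + i))" for f :: "nat \<Rightarrow> 'a::comm_monoid_add"
proof -
  have "(\<Sum>r<m * p. f r) = (\<Sum>k<p. \<Sum>r = k * m..<k * m + m. f r)"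
    using sum.nat_group[of f m p] by (simp add: mult.commute)
  moreover have "(\<Sum>r = k * m..<k * m + m. f r) = (\<Sum>i<m. f (k * m + i))" for k
    using sum.shift_bounds_nat_ivl[of f 0 "k * m" m] by (simp add: atLeast0LessThan add.commute)
  ultimately show ?thesis by simp
qed

lemma index_mult_mat_sum:
  assumes "A \<in> carrier_mat m k" "B \<in> carrier_mat k n" "i < m" "j < n"
  shows "(A * B) $$ (i, j) = (\<Sum>l<k. A $$ (i, l) * B $$ (l, j))"
  using assms by (auto simp: scalar_prod_def atLeast0LessThan)

lemma bcirc_carrier:
  assumes "A \<in> tensor_carrier m n p" "0 < p"
  shows "bcirc A \<in> carrier_mat (m * p) (n * p)"
  using tensor_dims[OF assms] by (simp add: bcirc_def Let_def)

lemma bcirc_index: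
  assumes "A \<in> tensor_carrier m n p" "k < p" "l < p" "i < m" "j < n"
  shows "bcirc A $$ (k * m + i, l * n + j) = A ! ((k + p - l) mod p) $$ (i, j)"
proof -
  have p: "0 < p" using assms by simp
  show ?thesis
    unfolding bcirc_def Let_def tensor_dims[OF assms(1) p]
    using assms block_index_less[of k p i m] block_index_less[of l p j n] by simp
qed

lemma bcirc_inj:
  assumes "A \<in> tensor_carrier m n p" "B \<in> tensor_carrier m n p" "0 < p" "bcirc A = bcirc B"
  shows "A = B"
proof (rule tensor_eqI[OF assms(1,2)])
  fix k i j assume "k < p" "i < m" "j < n"
  then show "A ! k $$ (i, j) = B ! k $$ (i, j)"
    using bcirc_index[OF assms(1), of k 0 i j] bcirc_index[OF assms(2), of k 0 i j] assms(3,4) by simp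
qed

lemma tunfold_carrier:
  assumes "A \<in> tensor_carrier m n p" "0 < p"
  shows "tunfold A \<in> carrier_mat (m * p) n"
  using tensor_dims[OF assms] by (simp add: tunfold_def Let_def)

lemma tunfold_index:
  assumes "A \<in> tensor_carrier m n p" "k < p" "i < m" "j < n"
  shows "tunfold A $$ (k * m + i, j) = A ! k $$ (i, j)"
proof -
  have p: "0 < p" using assms by simp
  show ?thesis
    unfolding tunfold_def Let_def tensor_dims[OF assms(1) p]
    using assms block_index_less[of k p i m] by simp
qed

lemma tfold_carrier:
  assumes "M \<in> carrier_mat (m * p) n" "0 < p"
  shows "tfold p M \<in> tensor_carrier m n p"
  using assms by (auto simp: tfold_def tensor_carrier_def Let_def)

lemma tfold_nth:
  assumes "M \<in> carrier_mat (m * p) n" "k < p" "i < m" "j < n"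
  shows "tfold p M ! k $$ (i, j) = M $$ (k * m + i, j)"
  using assms by (auto simp: tfold_def Let_def)

lemma tprod_carrier:
  assumes "A \<in> tensor_carrier m n p" "B \<in> tensor_carrier n q p" "0 < p"
  shows "A *\<^sub>T B \<in> tensor_carrier m q p"
  unfolding tprod_def tensor_dims[OF assms(1,3)]
  by (intro tfold_carrier mult_carrier_mat[OF bcirc_carrier[OF assms(1,3)] tunfold_carrier[OF assms(2,3)]] assms)

lemma tunfold_tprod:
  assumes "A \<in> tensor_carrier m n p" "B \<in> tensor_carrier n q p" "0 < p"
  shows "tunfold (A *\<^sub>T B) = bcirc A * tunfold B"
proof -
  note car = mult_carrier_mat[OF bcirc_carrier[OF assms(1,3)] tunfold_carrier[OF assms(2,3)]]
  have "tunfold (A *\<^sub>T B) $$ (k * m + i, 0 * q + j) = (bcirc A * tunfold B) $$ (k * m + i, 0 * q + j)"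
    if "k < p" "i < m" "j < q" for k i j
    using tunfold_index[OF tprod_carrier[OF assms] that] tfold_nth[OF car that]
    by (simp add: tprod_def tensor_dims[OF assms(1,3)])
  then show ?thesis
    using car tunfold_carrier[OF tprod_carrier[OF assms] assms(3)]
    by (intro mat_eq_blockI[of _ m p q 1]) auto
qed

lemma tprod_index:
  assumes "A \<in> tensor_carrier m n p" "B \<in> tensor_carrier n q p" "k < p" "i < m" "j < q"
  shows "(A *\<^sub>T B) ! k $$ (i, j) = (\<Sum>l<p. \<Sum>t<n. A ! ((k + p - l) mod p) $$ (i, t) * B ! l $$ (t, j))"
proof -
  have p: "0 < p" using assms by simp
  note cA = bcirc_carrier[OF assms(1) p] and cB = tunfold_carrier[OF assms(2) p]
  have "(A *\<^sub>T B) ! k $$ (i, j) = (bcirc A * tunfold B) $$ (k * m + i, j)"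
    unfolding tprod_def tensor_dims[OF assms(1) p]
    by (rule tfold_nth[OF mult_carrier_mat[OF cA cB] assms(3-5)])
  also have "\<dots> = (\<Sum>r<n * p. bcirc A $$ (k * m + i, r) * tunfold B $$ (r, j))"
    by (rule index_mult_mat_sum[OF cA cB block_index_less[OF assms(3,4)] assms(5)])
  also have "\<dots> = (\<Sum>l<p. \<Sum>t<n. bcirc A $$ (k * m + i, l * n + t) * tunfold B $$ (l * n + t, j))"
    by (rule sum_blocks)
  also have "\<dots> = (\<Sum>l<p. \<Sum>t<n. A ! ((k + p - l) mod p) $$ (i, t) * B ! l $$ (t, j))"
    using assms by (intro sum.cong) (auto simp: bcirc_index[OF assms(1)] tunfold_index[OF assms(2)])
  finally show ?thesis .
qed

lemma mod_add_bij:
  fixes c p :: nat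
  shows "bij_betw (\<lambda>l. (l + c) mod p) {..<p} {..<p}"
proof (cases "p = 0")
  case False
  then have p: "0 < p" by simp
  \<comment> \<open>The residue of \<open>- c\<close> modulo \<open>p\<close>.\<close>
  define e where "e = p - c mod p"
  have "e + c mod p = p" "p * (c div p) + c mod p = c"
    using p mod_less_divisor[OF p, of c] by (simp_all add: e_def)
  then have "c + e = p * (c div p) + p" by linarith
  then have "c + e = p * (c div p + 1)" by simp
  then have ce: "(x + (c + e)) mod p = x mod p" for x
    by (metis mod_mult_self2)
  show ?thesis
  proof (rule bij_betw_byWitness[where f' = "\<lambda>l. (l + e) mod p"])
    show "\<forall>l\<in>{..<p}. ((l + c) mod p + e) mod p = l"
      using ce by (simp add: mod_add_left_eq add.assoc)
    show "\<forall>l\<in>{..<p}. ((l + e) mod p + c) mod p = l"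
      using ce by (simp add: mod_add_left_eq add.assoc add.commute[of e c])
  qed (use p in auto)
qed (simp add: bij_betw_def)

lemma mod_shift_bij:
  fixes c p :: nat
  assumes "c < p"
  shows "bij_betw (\<lambda>l. (l + p - c) mod p) {..<p} {..<p}"
  using mod_add_bij[of "p - c" p] assms by simp

lemma mod_diff_eq_if:
  fixes x y p :: nat
  assumes "x < p" "y < p"
  shows "(x + p - y) mod p = (if y \<le> x then x - y else x + p - y)"
proof (cases "y \<le> x")
  case True
  then have "x + p - y = (x - y) + p" by simp
  moreover have "((x - y) + p) mod p = x - y"
    using assms by simp
  ultimately show ?thesis using True by (simp only: if_True)
qed (use assms in auto)

lemma mod_diff_diff:
  fixes k l c p :: nat
  assumes "k < p" "l < p" "c < p"
  shows "((k + p - c) mod p + p - (l + p - c) mod p) mod p = (k + p - l) mod p"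
proof -
  have "(k + p - c) mod p < p" "(l + p - c) mod p < p"
    using assms by auto
  then show ?thesis
    using assms by (simp add: mod_diff_eq_if) arith
qed

text \<open>
  The block at \<open>(k, c)\<close> of the product of the block circulant matrices is the sum over \<open>l\<close> of
  \<open>A\<^bsub>k - l\<^esub> B\<^bsub>l - c\<^esub>\<close>, with indices modulo \<open>p\<close>. Substituting \<open>l + c\<close> for \<open>l\<close> shows that it depends on
  \<open>k - c\<close> only and is slice \<open>k - c\<close> of the T-product.
\<close>

lemma bcirc_tprod:
  assumes "A \<in> tensor_carrier m n p" "B \<in> tensor_carrier n q p" "0 < p"
  shows "bcirc (A *\<^sub>T B) = bcirc A * bcirc B"
proof (rule mat_eq_blockI[of _ m p q p])
  note cA = bcirc_carrier[OF assms(1,3)] and cB = bcirc_carrier[OF assms(2,3)]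
  show "bcirc (A *\<^sub>T B) \<in> carrier_mat (m * p) (q * p)"
    by (rule bcirc_carrier[OF tprod_carrier[OF assms] assms(3)])
  show "bcirc A * bcirc B \<in> carrier_mat (m * p) (q * p)"
    using cA cB by simp
  fix k c i j assume b: "k < p" "c < p" "i < m" "j < q"
  let ?s = "(k + p - c) mod p"
  have s: "?s < p" using assms by simp
  have "(bcirc A * bcirc B) $$ (k * m + i, c * q + j) =
      (\<Sum>r<n * p. bcirc A $$ (k * m + i, r) * bcirc B $$ (r, c * q + j))"
    by (rule index_mult_mat_sum[OF cA cB block_index_less[OF b(1,3)] block_index_less[OF b(2,4)]])
  also have "\<dots> = (\<Sum>l<p. \<Sum>t<n. bcirc A $$ (k * m + i, l * n + t) * bcirc B $$ (l * n + t, c * q + j))"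
    by (rule sum_blocks)
  also have "\<dots> = (\<Sum>l<p. \<Sum>t<n. A ! ((k + p - l) mod p) $$ (i, t) * B ! ((l + p - c) mod p) $$ (t, j))"
    using b by (intro sum.cong) (auto simp: bcirc_index[OF assms(1)] bcirc_index[OF assms(2)])
  also have "\<dots> = (\<Sum>l<p. \<Sum>t<n. A ! ((?s + p - (l + p - c) mod p) mod p) $$ (i, t) * B ! ((l + p - c) mod p) $$ (t, j))"
    using b by (intro sum.cong) (auto simp: mod_diff_diff)
  also have "\<dots> = (\<Sum>l<p. \<Sum>t<n. A ! ((?s + p - l) mod p) $$ (i, t) * B ! l $$ (t, j))"
    by (rule sum.reindex_bij_betw[OF mod_shift_bij[OF b(2)]])
  also have "\<dots> = (A *\<^sub>T B) ! ?s $$ (i, j)"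
    by (rule tprod_index[OF assms(1,2) s b(3,4), symmetric])
  also have "\<dots> = bcirc (A *\<^sub>T B) $$ (k * m + i, c * q + j)"
    by (rule bcirc_index[OF tprod_carrier[OF assms] b, symmetric])
  finally show "bcirc (A *\<^sub>T B) $$ (k * m + i, c * q + j) = (bcirc A * bcirc B) $$ (k * m + i, c * q + j)" ..
qed

lemma tadd_carrier:
  "A \<in> tensor_carrier m n p \<Longrightarrow> B \<in> tensor_carrier m n p \<Longrightarrow> A +\<^sub>T B \<in> tensor_carrier m n p"
  by (auto simp: tensor_carrier_def tadd_def)

lemma tminus_carrier:
  "A \<in> tensor_carrier m n p \<Longrightarrow> B \<in> tensor_carrier m n p \<Longrightarrow> A -\<^sub>T B \<in> tensor_carrier m n p"
  by (auto simp: tensor_carrier_def tminus_def)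

lemma tsmult_carrier: "A \<in> tensor_carrier m n p \<Longrightarrow> c \<cdot>\<^sub>T A \<in> tensor_carrier m n p"
  by (auto simp: tensor_carrier_def tsmult_def)

lemma tident_carrier: "tident n p \<in> tensor_carrier n n p"
  by (auto simp: tensor_carrier_def tident_def)

lemma tzero_carrier: "tzero m n p \<in> tensor_carrier m n p"
  by (auto simp: tensor_carrier_def tzero_def)

lemma tadjoint_nth:
  assumes "A \<in> tensor_carrier m n p" "k < p"
  shows "tadjoint A ! k = mat_adjoint (A ! ((p - k) mod p))"
proof -
  have len: "length A = p" and ne: "A \<noteq> []" using assms by (auto simp: tensor_carrier_def)
  show ?thesis
  proof (cases k)
    case 0
    then show ?thesis using assms ne len by (simp add: tadjoint_def hd_conv_nth)
  next
    case (Suc j)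
    have "rev (tl A) ! j = tl A ! (p - 1 - Suc j)"
      using assms Suc len by (subst rev_nth) auto
    also have "\<dots> = A ! Suc (p - 1 - Suc j)"
      using assms Suc len by (intro nth_tl) auto
    also have "Suc (p - 1 - Suc j) = (p - k) mod p"
      using assms Suc by simp
    finally show ?thesis
      using assms Suc len by (simp add: tadjoint_def)
  qed
qed

lemma tadjoint_carrier:
  assumes "A \<in> tensor_carrier m n p" "0 < p"
  shows "tadjoint A \<in> tensor_carrier n m p"
proof -
  have "length (tadjoint A) = p"
    using assms by (simp add: tensor_carrier_def tadjoint_def)
  moreover have "tadjoint A ! k \<in> carrier_mat n m" if "k < p" for k
    unfolding tadjoint_nth[OF assms(1) that]
    using assms by (intro mat_adjoint_carrier tensor_carrier_nth) auto
  ultimately show ?thesis by (simp add: tensor_carrier_def)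
qed

lemma bcirc_tadd:
  assumes "A \<in> tensor_carrier m n p" "B \<in> tensor_carrier m n p" "0 < p"
  shows "bcirc (A +\<^sub>T B) = bcirc A + bcirc B"
proof (rule mat_eq_blockI[of _ m p n p])
  fix k l i j assume b: "k < p" "l < p" "i < m" "j < n"
  let ?s = "(k + p - l) mod p"
  have s: "?s < p" using assms by simp
  have "(A +\<^sub>T B) ! ?s = A ! ?s + B ! ?s"
    using s assms by (simp add: tadd_def tensor_carrier_length)
  then show "bcirc (A +\<^sub>T B) $$ (k * m + i, l * n + j) = (bcirc A + bcirc B) $$ (k * m + i, l * n + j)"
    using b bcirc_carrier[OF assms(1,3)] bcirc_carrier[OF assms(2,3)] tensor_carrier_nth[OF assms(2) s]
      block_index_less[of k p i m] block_index_less[of l p j n]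
    by (simp add: bcirc_index[OF tadd_carrier[OF assms(1,2)]] bcirc_index[OF assms(1)] bcirc_index[OF assms(2)])
qed (use assms bcirc_carrier[OF tadd_carrier[OF assms(1,2)]] bcirc_carrier in auto)

lemma bcirc_tminus:
  assumes "A \<in> tensor_carrier m n p" "B \<in> tensor_carrier m n p" "0 < p"
  shows "bcirc (A -\<^sub>T B) = bcirc A - bcirc B"
proof (rule mat_eq_blockI[of _ m p n p])
  fix k l i j assume b: "k < p" "l < p" "i < m" "j < n"
  let ?s = "(k + p - l) mod p"
  have s: "?s < p" using assms by simp
  have "(A -\<^sub>T B) ! ?s = A ! ?s - B ! ?s"
    using s assms by (simp add: tminus_def tensor_carrier_length)
  then show "bcirc (A -\<^sub>T B) $$ (k * m + i, l * n + j) = (bcirc A - bcirc B) $$ (k * m + i, l * n + j)"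
    using b bcirc_carrier[OF assms(1,3)] bcirc_carrier[OF assms(2,3)] tensor_carrier_nth[OF assms(2) s]
      block_index_less[of k p i m] block_index_less[of l p j n]
    by (simp add: bcirc_index[OF tminus_carrier[OF assms(1,2)]] bcirc_index[OF assms(1)] bcirc_index[OF assms(2)])
qed (use assms bcirc_carrier[OF tminus_carrier[OF assms(1,2)]] bcirc_carrier in auto)

lemma bcirc_tsmult:
  assumes "A \<in> tensor_carrier m n p" "0 < p"
  shows "bcirc (c \<cdot>\<^sub>T A) = c \<cdot>\<^sub>m bcirc A"
proof (rule mat_eq_blockI[of _ m p n p])
  fix k l i j assume b: "k < p" "l < p" "i < m" "j < n"
  let ?s = "(k + p - l) mod p"
  have s: "?s < p" using assms by simp
  have "(c \<cdot>\<^sub>T A) ! ?s = c \<cdot>\<^sub>m A ! ?s"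
    using s assms by (simp add: tsmult_def tensor_carrier_length)
  then show "bcirc (c \<cdot>\<^sub>T A) $$ (k * m + i, l * n + j) = (c \<cdot>\<^sub>m bcirc A) $$ (k * m + i, l * n + j)"
    using b bcirc_carrier[OF assms] tensor_carrier_nth[OF assms(1) s]
      block_index_less[of k p i m] block_index_less[of l p j n]
    by (simp add: bcirc_index[OF tsmult_carrier[OF assms(1)]] bcirc_index[OF assms(1)])
qed (use assms bcirc_carrier[OF tsmult_carrier[OF assms(1)]] bcirc_carrier in auto)

lemma bcirc_tident:
  assumes "0 < p"
  shows "bcirc (tident n p) = 1\<^sub>m (n * p)"
proof (rule mat_eq_blockI[of _ n p n p])
  fix k l i j assume b: "k < p" "l < p" "i < n" "j < n"
  have "(k + p - l) mod p = 0 \<longleftrightarrow> k = l"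
    using b by (auto simp: mod_diff_eq_if)
  moreover have "k * n + i = l * n + j \<longleftrightarrow> k = l \<and> i = j"
  proof
    assume eq: "k * n + i = l * n + j"
    have "k = (k * n + i) div n" "l = (l * n + j) div n" using b by auto
    then have "k = l" using eq by metis
    then show "k = l \<and> i = j" using eq by simp
  qed simp
  ultimately show "bcirc (tident n p) $$ (k * n + i, l * n + j) = 1\<^sub>m (n * p) $$ (k * n + i, l * n + j)"
    using b block_index_less[of k p i n] block_index_less[of l p j n]
    unfolding bcirc_index[OF tident_carrier b] by (simp add: tident_def)
qed (use assms bcirc_carrier[OF tident_carrier] in auto)

lemma bcirc_tadjoint:
  assumes "A \<in> tensor_carrier m n p" "0 < p"
  shows "bcirc (tadjoint A) = mat_adjoint (bcirc A)"
proof (rule mat_eq_blockI[of _ n p m p])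
  fix k l i j assume b: "k < p" "l < p" "i < n" "j < m"
  let ?s = "(k + p - l) mod p"
  have s: "?s < p" "(l + p - k) mod p < p" using assms by simp_all
  have "(p - ?s) mod p = (l + p - k) mod p"
    using b by (auto simp: mod_diff_eq_if)
  then have "tadjoint A ! ?s = mat_adjoint (A ! ((l + p - k) mod p))"
    using tadjoint_nth[OF assms(1) s(1)] by simp
  then show "bcirc (tadjoint A) $$ (k * n + i, l * m + j) = mat_adjoint (bcirc A) $$ (k * n + i, l * m + j)"
    using b bcirc_carrier[OF assms] tensor_carrier_nth[OF assms(1) s(2)]
      block_index_less[of k p i n] block_index_less[of l p j m]
    by (simp add: bcirc_index[OF tadjoint_carrier[OF assms]] bcirc_index[OF assms(1)])
qed (use assms bcirc_carrier[OF tadjoint_carrier[OF assms]] bcirc_carrier in auto)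

section \<open>Tensors with one column as vectors\<close>

definition tvec :: "tensor \<Rightarrow> complex vec" where
  "tvec X = col (tunfold X) 0"

lemma tvec_carrier:
  assumes "X \<in> tensor_carrier n 1 p" "0 < p"
  shows "tvec X \<in> carrier_vec (n * p)"
  using tunfold_carrier[OF assms] unfolding tvec_def by (metis carrier_matD(1) carrier_vecI col_dim)

lemma tvec_index:
  assumes "X \<in> tensor_carrier n 1 p" "k < p" "i < n"
  shows "tvec X $ (k * n + i) = X ! k $$ (i, 0)"
proof -
  have p: "0 < p" using assms by simp
  show ?thesis
    using tunfold_index[OF assms, of 0] tunfold_carrier[OF assms(1) p] block_index_less[OF assms(2,3)]
    by (simp add: tvec_def)
qed

lemma tvec_surj:
  assumes "v \<in> carrier_vec (n * p)" "0 < p"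
  obtains X where "X \<in> tensor_carrier n 1 p" "tvec X = v"
proof
  let ?M = "mat (n * p) 1 (\<lambda>(r, c). v $ r)"
  let ?X = "tfold p ?M"
  show X: "?X \<in> tensor_carrier n 1 p"
    using assms by (intro tfold_carrier) auto
  show "tvec ?X = v"
  proof (rule eq_vecI)
    fix r assume "r < dim_vec v"
    then have r: "r < n * p" using assms by simp
    have "tvec ?X $ (r div n * n + r mod n) = v $ r"
      using tvec_index[OF X block_index_split(1,2)[OF r]] tfold_nth[of ?M n p 1 "r div n" "r mod n" 0]
        block_index_split[OF r] r by simp
    then show "tvec ?X $ r = v $ r" by simp
  qed (use tvec_carrier[OF X assms(2)] assms in simp)
qed

lemma tvec_eq_zero_iff:
  assumes "X \<in> tensor_carrier n 1 p" "0 < p"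
  shows "tvec X = 0\<^sub>v (n * p) \<longleftrightarrow> X = tzero n 1 p"
proof
  assume eq: "tvec X = 0\<^sub>v (n * p)"
  show "X = tzero n 1 p"
  proof (rule tensor_eqI[OF assms(1) tzero_carrier])
    fix k i j assume "k < p" "i < n" "j < (1 :: nat)"
    then show "X ! k $$ (i, j) = tzero n 1 p ! k $$ (i, j)"
      using tvec_index[OF assms(1), of k i] block_index_less[of k p i n] by (simp add: eq tzero_def)
  qed
next
  assume X: "X = tzero n 1 p"
  show "tvec X = 0\<^sub>v (n * p)"
  proof (rule eq_vecI)
    fix r assume "r < dim_vec (0\<^sub>v (n * p) :: complex vec)"
    then have r: "r < n * p" by simp
    have "tvec X $ (r div n * n + r mod n) = 0"
      unfolding tvec_index[OF assms(1) block_index_split(1,2)[OF r]]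
      using block_index_split[OF r] by (simp add: X tzero_def)
    then show "tvec X $ r = 0\<^sub>v (n * p) $ r" using r by simp
  qed (use tvec_carrier[OF assms] in simp)
qed

lemma tinner_conv_tvec:
  assumes X: "X \<in> tensor_carrier n 1 p" and Y: "Y \<in> tensor_carrier n 1 p" and p: "0 < p"
  shows "tinner X Y = tvec Y \<bullet>c tvec X"
proof -
  have "tvec Y \<bullet>c tvec X = (\<Sum>r<n * p. tvec Y $ r * cnj (tvec X $ r))"
    using tvec_carrier[OF X p] tvec_carrier[OF Y p] by (simp add: scalar_prod_def atLeast0LessThan)
  also have "\<dots> = (\<Sum>k<p. \<Sum>i<n. tvec Y $ (k * n + i) * cnj (tvec X $ (k * n + i)))"
    by (rule sum_blocks)
  also have "\<dots> = (\<Sum>k<p. \<Sum>i<n. cnj (X ! k $$ (i, 0)) * Y ! k $$ (i, 0))"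
    by (intro sum.cong) (auto simp: tvec_index[OF X] tvec_index[OF Y])
  also have "\<dots> = (\<Sum>i<n. \<Sum>k<p. cnj (X ! k $$ (i, 0)) * Y ! k $$ (i, 0))"
    by (rule sum.swap)
  also have "\<dots> = tinner X Y"
    unfolding tinner_def tensor_dims[OF X p] by simp
  finally show ?thesis ..
qed

text \<open>
  The quadratic form that defines positivity of a tensor is the quadratic form of its block
  circulant matrix.
\<close>

lemma tinner_tprod:
  assumes A: "A \<in> tensor_carrier n n p" and X: "X \<in> tensor_carrier n 1 p" and p: "0 < p"
  shows "tinner X (A *\<^sub>T X) = (bcirc A *\<^sub>v tvec X) \<bullet>c tvec X"
proof -
  have "tvec (A *\<^sub>T X) = bcirc A *\<^sub>v tvec X"
    unfolding tvec_def tunfold_tprod[OF A X p]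
    by (rule col_mult2[OF bcirc_carrier[OF A p] tunfold_carrier[OF X p]]) simp
  then show ?thesis
    using tinner_conv_tvec[OF X tprod_carrier[OF A X p] p] by simp
qed

section \<open>Block circulant matrices as the matrices invariant under the block shift\<close>

text \<open>
  The permutation matrix of the cyclic shift \<open>r \<mapsto> r + n\<close> modulo \<open>N\<close>. For \<open>N = n * p\<close> it moves each of the
  \<open>p\<close> blocks of length \<open>n\<close> to the next one.
\<close>

definition shift_mat :: "nat \<Rightarrow> nat \<Rightarrow> complex mat" where
  "shift_mat n N = mat N N (\<lambda>(r, c). if r = (c + n) mod N then 1 else 0)"

lemma shift_mat_carrier: "shift_mat n N \<in> carrier_mat N N"
  by (simp add: shift_mat_def)

lemma shift_mat_congruence_index:
  assumes M: "M \<in> carrier_mat N N" and rc: "r < N" "c < N"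
  shows "(mat_adjoint (shift_mat n N) * M * shift_mat n N) $$ (r, c) = M $$ ((r + n) mod N, (c + n) mod N)"
proof -
  note P = shift_mat_carrier[of n N]
  define K where "K = mat_adjoint (shift_mat n N) * M"
  have K: "K \<in> carrier_mat N N"
    unfolding K_def by (rule mult_carrier_mat[OF mat_adjoint_carrier[OF P] M])
  have K_index: "K $$ (r, y) = M $$ ((r + n) mod N, y)" if y: "y < N" for y
  proof -
    have "K $$ (r, y) = (\<Sum>x<N. (if x = (r + n) mod N then 1 else 0) * M $$ (x, y))"
      unfolding K_def index_mult_mat_sum[OF mat_adjoint_carrier[OF P] M rc(1) y]
      using P rc by (intro sum.cong) (auto simp: shift_mat_def)
    also have "\<dots> = (\<Sum>x<N. if x = (r + n) mod N then M $$ (x, y) else 0)"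
      by (intro sum.cong) auto
    finally show ?thesis using rc by simp
  qed
  have "(K * shift_mat n N) $$ (r, c) = (\<Sum>y<N. K $$ (r, y) * shift_mat n N $$ (y, c))"
    by (rule index_mult_mat_sum[OF K P rc])
  also have "\<dots> = (\<Sum>y<N. if y = (c + n) mod N then M $$ ((r + n) mod N, y) else 0)"
    using rc by (intro sum.cong) (auto simp: K_index shift_mat_def)
  finally show ?thesis using rc by (simp add: K_def)
qed

lemma shift_mat_unitary:
  "mat_adjoint (shift_mat n N) * shift_mat n N = 1\<^sub>m N"
  "shift_mat n N * mat_adjoint (shift_mat n N) = 1\<^sub>m N"
proof -
  note P = shift_mat_carrier[of n N]
  show 1: "mat_adjoint (shift_mat n N) * shift_mat n N = 1\<^sub>m N"
  proof (rule eq_matI)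
    fix r c assume "r < dim_row (1\<^sub>m N :: complex mat)" "c < dim_col (1\<^sub>m N :: complex mat)"
    then have rc: "r < N" "c < N" by auto
    have "(r + n) mod N = (c + n) mod N \<longleftrightarrow> r = c"
      using inj_on_eq_iff[OF bij_betw_imp_inj_on[OF mod_add_bij[of n N]], of r c] rc by simp
    moreover have "mat_adjoint (shift_mat n N) * 1\<^sub>m N = mat_adjoint (shift_mat n N)"
      by (rule right_mult_one_mat[OF mat_adjoint_carrier[OF P]])
    ultimately show "(mat_adjoint (shift_mat n N) * shift_mat n N) $$ (r, c) = 1\<^sub>m N $$ (r, c)"
      using shift_mat_congruence_index[of "1\<^sub>m N" N r c n] rc by simp
  qed (use P in auto)
  show "shift_mat n N * mat_adjoint (shift_mat n N) = 1\<^sub>m N"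
    using mat_mult_left_right_inverse[OF mat_adjoint_carrier[OF P] P 1] .
qed

lemma block_shift_index:
  fixes k i n p :: nat
  assumes "k < p" "i < n"
  shows "(k * n + i + n) mod (n * p) = (k + 1) mod p * n + i"
proof (cases "k + 1 < p")
  case True
  then show ?thesis
    using block_index_less[OF True assms(2)] by (simp add: algebra_simps)
next
  case False
  then have k: "p = k + 1" using assms by simp
  have "k * n + i + n = i + n * p" by (simp add: k algebra_simps)
  then have "(k * n + i + n) mod (n * p) = i mod (n * p)" by (simp only: mod_add_self2)
  also have "\<dots> = i" using assms k by (intro mod_less) (simp add: trans_less_add1)
  finally show ?thesis by (simp add: k)
qed

lemma bcirc_shift_invariant:
  assumes A: "A \<in> tensor_carrier n n p" and p: "0 < p"
  shows "mat_adjoint (shift_mat n (n * p)) * bcirc A * shift_mat n (n * p) = bcirc A"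
proof (rule mat_eq_blockI[of _ n p n p])
  note P = shift_mat_carrier[of n "n * p"]
  show "mat_adjoint (shift_mat n (n * p)) * bcirc A * shift_mat n (n * p) \<in> carrier_mat (n * p) (n * p)"
    by (rule mult_carrier_mat[OF mult_carrier_mat[OF mat_adjoint_carrier[OF P] bcirc_carrier[OF A p]] P])
  fix k l i j assume b: "k < p" "l < p" "i < n" "j < n"
  have "((k + 1) mod p + p - (l + 1) mod p) mod p = (k + p - l) mod p"
  proof -
    have succ: "(x + 1) mod p = (if x + 1 = p then 0 else x + 1)" if "x < p" for x
      using that by auto
    have "((k + 1) mod p + p - (l + 1) mod p) mod p
        = (if (l + 1) mod p \<le> (k + 1) mod p then (k + 1) mod p - (l + 1) mod p
           else (k + 1) mod p + p - (l + 1) mod p)"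
      using p by (intro mod_diff_eq_if) simp_all
    also have "\<dots> = (if l \<le> k then k - l else k + p - l)"
      unfolding succ[OF b(1)] succ[OF b(2)] using b by auto
    also have "\<dots> = (k + p - l) mod p"
      using mod_diff_eq_if[OF b(1,2)] by simp
    finally show ?thesis .
  qed
  then show "(mat_adjoint (shift_mat n (n * p)) * bcirc A * shift_mat n (n * p)) $$ (k * n + i, l * n + j)
      = bcirc A $$ (k * n + i, l * n + j)"
    using b p bcirc_index[OF A, of "(k + 1) mod p" "(l + 1) mod p" i j] bcirc_index[OF A b]
    unfolding shift_mat_congruence_index[OF bcirc_carrier[OF A p] block_index_less[OF b(1,3)] block_index_less[OF b(2,4)]]
      block_shift_index[OF b(1,3)] block_shift_index[OF b(2,4)]
    by simp
qed (rule bcirc_carrier[OF A p])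

text \<open>
  Shifting both indices of a block until the column index becomes zero identifies every block with one
  of the first block column, and this column is unfolded from the required tensor.
\<close>

lemma shift_invariant_imp_bcirc:
  assumes M: "M \<in> carrier_mat (n * p) (n * p)" and p: "0 < p"
    and inv: "mat_adjoint (shift_mat n (n * p)) * M * shift_mat n (n * p) = M"
  obtains A where "A \<in> tensor_carrier n n p" "bcirc A = M"
proof
  let ?C = "mat (n * p) n (\<lambda>(r, c). M $$ (r, c))"
  let ?A = "tfold p ?C"
  show A: "?A \<in> tensor_carrier n n p"
    using p by (intro tfold_carrier) auto
  have step: "M $$ (k * n + i, l * n + j) = M $$ ((k + 1) mod p * n + i, (l + 1) mod p * n + j)"
    if b: "k < p" "l < p" "i < n" "j < n" for k l i j
    using shift_mat_congruence_index[OF M block_index_less[OF b(1,3)] block_index_less[OF b(2,4)], of n]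
    unfolding inv block_shift_index[OF b(1,3)] block_shift_index[OF b(2,4)] .
  have steps: "M $$ (k * n + i, l * n + j) = M $$ ((k + t) mod p * n + i, (l + t) mod p * n + j)"
    if b: "k < p" "l < p" "i < n" "j < n" for k l i j t
  proof (induction t)
    case 0
    then show ?case using b by simp
  next
    case (Suc t)
    have "((x + t) mod p + 1) mod p = (x + Suc t) mod p" for x
      by (simp add: mod_Suc_eq)
    then show ?case
      using Suc.IH step[of "(k + t) mod p" "(l + t) mod p" i j] b p by simp
  qed
  show "bcirc ?A = M"
  proof (rule mat_eq_blockI[OF bcirc_carrier[OF A p] M])
    fix k l i j assume b: "k < p" "l < p" "i < n" "j < n"
    let ?s = "(k + p - l) mod p"
    have s: "?s < p" using p by simp
    \<comment> \<open>Shifting by \<open>p - l\<close> blocks brings block column \<open>l\<close> to block column zero.\<close>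
    have "bcirc ?A $$ (k * n + i, l * n + j) = ?C $$ (?s * n + i, j)"
      unfolding bcirc_index[OF A b] using s b by (intro tfold_nth) auto
    also have "\<dots> = M $$ (?s * n + i, j)"
      using block_index_less[OF s b(3)] b by simp
    also have "\<dots> = M $$ (k * n + i, l * n + j)"
      using steps[OF b, of "p - l"] b by simp
    finally show "bcirc ?A $$ (k * n + i, l * n + j) = M $$ (k * n + i, l * n + j)" .
  qed
qed

section \<open>The T-Loewner order\<close>

text \<open>
  Because \<open>bcirc\<close> is injective and compatible with all operations, the order between tensors is the order
  between their block circulant matrices.
\<close>

lemma T_Herm_iff:
  assumes "0 < p"
  shows "A \<in> T_Herm n p \<longleftrightarrow> A \<in> tensor_carrier n n p \<and> bcirc A \<in> hermitian (n * p)"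
proof -
  have "tadjoint A = A \<longleftrightarrow> mat_adjoint (bcirc A) = bcirc A" if A: "A \<in> tensor_carrier n n p"
    using bcirc_inj[OF tadjoint_carrier[OF A assms] A assms] by (auto simp flip: bcirc_tadjoint[OF A assms])
  then show ?thesis
    using bcirc_carrier[of A n n p] assms by (auto simp: T_Herm_def hermitian_def)
qed

lemma T_Herm_D:
  assumes "A \<in> T_Herm n p" "0 < p"
  shows "A \<in> tensor_carrier n n p" "trows A = n" "tdepth A = p"
  using assms tensor_dims[of A n n p] by (auto simp: T_Herm_def)

lemma T_PD_iff:
  assumes p: "0 < p"
  shows "A \<in> T_PD n p \<longleftrightarrow> A \<in> tensor_carrier n n p \<and> bcirc A \<in> pd (n * p)"
proof -
  have "(\<forall>X\<in>tensor_carrier n 1 p. X \<noteq> tzero n 1 p \<longrightarrow> 0 < tinner X (A *\<^sub>T X)) \<longleftrightarrow>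
      (\<forall>v\<in>carrier_vec (n * p). v \<noteq> 0\<^sub>v (n * p) \<longrightarrow> 0 < qform (bcirc A) v)"
    if A: "A \<in> tensor_carrier n n p"
  proof
    assume *: "\<forall>X\<in>tensor_carrier n 1 p. X \<noteq> tzero n 1 p \<longrightarrow> 0 < tinner X (A *\<^sub>T X)"
    show "\<forall>v\<in>carrier_vec (n * p). v \<noteq> 0\<^sub>v (n * p) \<longrightarrow> 0 < qform (bcirc A) v"
    proof (intro ballI impI)
      fix v :: "complex vec" assume v: "v \<in> carrier_vec (n * p)" "v \<noteq> 0\<^sub>v (n * p)"
      obtain X where X: "X \<in> tensor_carrier n 1 p" "tvec X = v"
        using tvec_surj[OF v(1) p] .
      then show "0 < qform (bcirc A) v"
        using * v tvec_eq_zero_iff[OF X(1) p] tinner_tprod[OF A X(1) p] by (auto simp: qform_def)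
    qed
  next
    assume *: "\<forall>v\<in>carrier_vec (n * p). v \<noteq> 0\<^sub>v (n * p) \<longrightarrow> 0 < qform (bcirc A) v"
    show "\<forall>X\<in>tensor_carrier n 1 p. X \<noteq> tzero n 1 p \<longrightarrow> 0 < tinner X (A *\<^sub>T X)"
    proof (intro ballI impI)
      fix X assume X: "X \<in> tensor_carrier n 1 p" "X \<noteq> tzero n 1 p"
      then show "0 < tinner X (A *\<^sub>T X)"
        using * tvec_eq_zero_iff[OF X(1) p] tvec_carrier[OF X(1) p] tinner_tprod[OF A X(1) p]
        by (auto simp: qform_def)
    qed
  qed
  then show ?thesis
    using T_Herm_iff[OF p, of A n] unfolding T_PD_def pd_def by blast
qed

lemma T_PSD_iff:
  assumes p: "0 < p"
  shows "A \<in> T_PSD n p \<longleftrightarrow> A \<in> tensor_carrier n n p \<and> bcirc A \<in> psd (n * p)"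
proof -
  have "(\<forall>X\<in>tensor_carrier n 1 p. X \<noteq> tzero n 1 p \<longrightarrow> 0 \<le> tinner X (A *\<^sub>T X)) \<longleftrightarrow>
      (\<forall>v\<in>carrier_vec (n * p). 0 \<le> qform (bcirc A) v)"
    if A: "A \<in> tensor_carrier n n p"
  proof
    assume *: "\<forall>X\<in>tensor_carrier n 1 p. X \<noteq> tzero n 1 p \<longrightarrow> 0 \<le> tinner X (A *\<^sub>T X)"
    show "\<forall>v\<in>carrier_vec (n * p). 0 \<le> qform (bcirc A) v"
    proof
      fix v :: "complex vec" assume v: "v \<in> carrier_vec (n * p)"
      obtain X where X: "X \<in> tensor_carrier n 1 p" "tvec X = v"
        using tvec_surj[OF v p] .
      show "0 \<le> qform (bcirc A) v"
      proof (cases "v = 0\<^sub>v (n * p)")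
        case True
        then show ?thesis
          using mult_mat_zero_vec[OF bcirc_carrier[OF A p]] by (simp add: qform_def)
      next
        case False
        then show ?thesis
          using * X tvec_eq_zero_iff[OF X(1) p] tinner_tprod[OF A X(1) p] by (auto simp: qform_def)
      qed
    qed
  next
    assume *: "\<forall>v\<in>carrier_vec (n * p). 0 \<le> qform (bcirc A) v"
    show "\<forall>X\<in>tensor_carrier n 1 p. X \<noteq> tzero n 1 p \<longrightarrow> 0 \<le> tinner X (A *\<^sub>T X)"
      using * tvec_carrier p tinner_tprod[OF A] by (auto simp: qform_def)
  qed
  then show ?thesis
    using T_Herm_iff[OF p, of A n] unfolding T_PSD_def psd_def by blast
qed

lemma T_PD_D:
  assumes "A \<in> T_PD n p" "0 < p"
  shows "A \<in> tensor_carrier n n p" "bcirc A \<in> pd (n * p)" "A \<in> T_Herm n p"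
  using assms by (auto simp: T_PD_iff) (auto simp: T_Herm_iff pd_hermitian)

lemma tless_iff:
  assumes "A \<in> T_Herm n p" "B \<in> T_Herm n p" "0 < p"
  shows "A <\<^sub>T B \<longleftrightarrow> bcirc B - bcirc A \<in> pd (n * p)"
  using assms T_Herm_D[OF assms(1,3)] T_Herm_D[OF assms(2,3)]
  by (auto simp: tless_def Let_def T_PD_iff bcirc_tminus tminus_carrier)

lemma tless_eq_iff:
  assumes "A \<in> T_Herm n p" "B \<in> T_Herm n p" "0 < p"
  shows "A \<le>\<^sub>T B \<longleftrightarrow> bcirc B - bcirc A \<in> psd (n * p)"
  using assms T_Herm_D[OF assms(1,3)] T_Herm_D[OF assms(2,3)]
  by (auto simp: tless_eq_def Let_def T_PSD_iff bcirc_tminus tminus_carrier)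

lemma shift_congruence_mult:
  fixes n N :: nat and M K :: "complex mat"
  defines "P \<equiv> shift_mat n N"
  assumes M: "M \<in> carrier_mat N N" and K: "K \<in> carrier_mat N N"
  shows "(mat_adjoint P * M * P) * (mat_adjoint P * K * P) = mat_adjoint P * (M * K) * P"
proof -
  have P: "P \<in> carrier_mat N N" unfolding P_def by (rule shift_mat_carrier)
  have "P * (mat_adjoint P * X) = X" if "X \<in> carrier_mat N N" for X
    using mult_inverse_cancel[OF P mat_adjoint_carrier[OF P]] shift_mat_unitary(2) that unfolding P_def by blast
  then show ?thesis
    using P M K by (simp add: square_assoc[of _ N])
qed

text \<open>
  The block circulant matrix of \<open>A\<close> has a matrix inverse. Conjugating that inverse by the block shift gives
  another inverse, because conjugation leaves the block circulant matrix fixed. Hence the inverse is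
  itself invariant under the shift, that is, block circulant.
\<close>

lemma tinv_T_PD:
  assumes A: "A \<in> T_PD n p" and p: "0 < p"
  shows "tinv A \<in> T_PD n p" "bcirc A * bcirc (tinv A) = 1\<^sub>m (n * p)"
proof -
  let ?N = "n * p"
  note tA = T_PD_D[OF A p]
  note cA = pdD(1)[OF tA(2)]
  obtain S R where R: "R \<in> pd ?N" "bcirc A * R = 1\<^sub>m ?N" "R * bcirc A = 1\<^sub>m ?N"
    using pd_square_root_and_inverse[OF tA(2)] by metis
  note cR = pdD(1)[OF R(1)]
  define P where "P = shift_mat n ?N"
  have P: "P \<in> carrier_mat ?N ?N" unfolding P_def by (rule shift_mat_carrier)
  have cPR: "mat_adjoint P * R * P \<in> carrier_mat ?N ?N"
    using P cR by simp
  have "bcirc A * (mat_adjoint P * R * P) = (mat_adjoint P * bcirc A * P) * (mat_adjoint P * R * P)"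
    using bcirc_shift_invariant[OF tA(1) p] by (simp only: P_def)
  also have "\<dots> = mat_adjoint P * (bcirc A * R) * P"
    unfolding P_def by (rule shift_congruence_mult[OF cA cR])
  also have "\<dots> = 1\<^sub>m ?N"
    using P shift_mat_unitary(1)[of n ?N] by (simp add: R(2) P_def)
  finally have inv: "bcirc A * (mat_adjoint P * R * P) = 1\<^sub>m ?N" .
  have "R * (bcirc A * (mat_adjoint P * R * P)) = mat_adjoint P * R * P"
    by (rule mult_inverse_cancel[OF cR cA R(3) cPR])
  then have fixed: "mat_adjoint P * R * P = R"
    using cR by (simp add: inv)
  obtain X where X: "X \<in> tensor_carrier n n p" "bcirc X = R"
    by (rule shift_invariant_imp_bcirc[OF cR p fixed[unfolded P_def]])
  have "tinv A = X"
    unfolding tinv_def Let_def tensor_dims[OF tA(1) p]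
  proof (rule the_equality)
    have "A *\<^sub>T X = tident n p" "X *\<^sub>T A = tident n p"
      using X R(2,3) tA(1) p
      by (auto intro!: bcirc_inj[of _ n n p] tprod_carrier tident_carrier simp: bcirc_tprod bcirc_tident)
    then show "X \<in> tensor_carrier n n p \<and> A *\<^sub>T X = tident n p \<and> X *\<^sub>T A = tident n p"
      using X by blast
    fix Y assume Y: "Y \<in> tensor_carrier n n p \<and> A *\<^sub>T Y = tident n p \<and> Y *\<^sub>T A = tident n p"
    then have cY: "bcirc Y \<in> carrier_mat ?N ?N" and AY: "bcirc A * bcirc Y = 1\<^sub>m ?N"
      using tA(1) p bcirc_carrier[of Y n n p] bcirc_tprod[of A n n p Y n] by (auto simp: bcirc_tident)
    have "bcirc Y = R"
      using mult_inverse_cancel[OF cR cA R(3) cY] AY cR by simp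
    then show "Y = X"
      using Y X p by (intro bcirc_inj[of Y n n p X]) auto
  qed
  then show "tinv A \<in> T_PD n p" "bcirc A * bcirc (tinv A) = 1\<^sub>m ?N"
    using X R by (auto simp: T_PD_iff[OF p])
qed

text \<open>
  As for the inverse: conjugation by the block shift is unitary, so it maps the positive definite square
  root of a block circulant matrix to a positive definite square root of the same matrix, and
  uniqueness makes the root invariant.
\<close>

lemma tsqrt_T_PD:
  assumes A: "A \<in> T_PD n p" and p: "0 < p"
  shows "tsqrt A \<in> T_PD n p" "bcirc (tsqrt A) * bcirc (tsqrt A) = bcirc A"
proof -
  let ?N = "n * p"
  note tA = T_PD_D[OF A p]
  obtain S where S: "S \<in> pd ?N" "S * S = bcirc A"
    using pd_square_root_and_inverse[OF tA(2)] by metis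
  note cS = pdD(1)[OF S(1)]
  define P where "P = shift_mat n ?N"
  have P: "P \<in> carrier_mat ?N ?N" unfolding P_def by (rule shift_mat_carrier)
  have "(mat_adjoint P * S * P) * (mat_adjoint P * S * P) = mat_adjoint P * (S * S) * P"
    unfolding P_def by (rule shift_congruence_mult[OF cS cS])
  also have "\<dots> = S * S"
    unfolding S(2) P_def by (rule bcirc_shift_invariant[OF tA(1) p])
  finally have sq: "(mat_adjoint P * S * P) * (mat_adjoint P * S * P) = S * S" .
  have "mat_adjoint P * S * P \<in> pd ?N"
    using pd_congruence[OF S(1) P mat_adjoint_carrier[OF P]] shift_mat_unitary(1) by (simp only: P_def)
  then have fixed: "mat_adjoint P * S * P = S"
    using pd_square_root_unique[OF _ S(1) sq] by blast
  obtain X where X: "X \<in> tensor_carrier n n p" "bcirc X = S"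
    by (rule shift_invariant_imp_bcirc[OF cS p fixed[unfolded P_def]])
  have "tsqrt A = X"
    unfolding tsqrt_def tensor_dims[OF tA(1) p]
  proof (rule the_equality)
    have "X *\<^sub>T X = A"
      using X S(2) tA(1) p by (intro bcirc_inj[of _ n n p] tprod_carrier) (auto simp: bcirc_tprod)
    then show "X \<in> T_PD n p \<and> X *\<^sub>T X = A"
      using X S(1) by (simp add: T_PD_iff[OF p])
    fix Y assume Y: "Y \<in> T_PD n p \<and> Y *\<^sub>T Y = A"
    then have tY: "Y \<in> tensor_carrier n n p" "bcirc Y \<in> pd ?N"
      by (auto simp: T_PD_iff[OF p])
    have "bcirc Y * bcirc Y = S * S"
      using Y tY p by (simp add: S(2) bcirc_tprod flip: bcirc_tprod[OF tY(1) tY(1) p])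
    then have "bcirc Y = bcirc X"
      using pd_square_root_unique[OF tY(2) S(1)] X by simp
    then show "Y = X"
      by (rule bcirc_inj[OF tY(1) X(1) p])
  qed
  then show "tsqrt A \<in> T_PD n p" "bcirc (tsqrt A) * bcirc (tsqrt A) = bcirc A"
    using X S by (auto simp: T_PD_iff[OF p])
qed

text \<open>
  The tensor geometric mean enters the final argument only through its positive definiteness and its
  Riccati equation.
\<close>

lemma tgmean_T_PD:
  assumes A: "A \<in> T_PD n p" and B: "B \<in> T_PD n p" and p: "0 < p"
  shows "A #\<^sub>T B \<in> T_PD n p" "bcirc (A #\<^sub>T B) * bcirc (tinv A) * bcirc (A #\<^sub>T B) = bcirc B"
proof -
  let ?N = "n * p"
  define S where "S = tsqrt A"
  define R where "R = tinv S"
  define Z where "Z = R *\<^sub>T B *\<^sub>T R"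
  define T where "T = tsqrt Z"
  note S = tsqrt_T_PD[OF A p, folded S_def]
  note R = tinv_T_PD[OF S(1) p, folded R_def]
  note tA = T_PD_D[OF A p] and tB = T_PD_D[OF B p] and tS = T_PD_D[OF S(1) p] and tR = T_PD_D[OF R(1) p]
  have bZ: "bcirc Z = bcirc R * bcirc B * bcirc R" and cZ: "Z \<in> tensor_carrier n n p"
    unfolding Z_def using tR(1) tB(1) p by (simp_all add: bcirc_tprod[of _ n n p _ n] tprod_carrier[of _ n n p _ n])
  have "bcirc Z \<in> pd ?N"
    unfolding bZ using pd_sandwich[OF tB(2) pd_hermitian[OF tR(2)] pdD(1)[OF tS(2)] R(2)] .
  then have Z: "Z \<in> T_PD n p"
    using cZ by (simp add: T_PD_iff[OF p])
  note T = tsqrt_T_PD[OF Z p, folded T_def]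
  note tT = T_PD_D[OF T(1) p]
  have G: "A #\<^sub>T B = S *\<^sub>T T *\<^sub>T S"
    unfolding tgmean_def S_def R_def Z_def T_def ..
  have bG: "bcirc (A #\<^sub>T B) = bcirc S * bcirc T * bcirc S" and cG: "A #\<^sub>T B \<in> tensor_carrier n n p"
    unfolding G using tS(1) tT(1) p by (simp_all add: bcirc_tprod[of _ n n p _ n] tprod_carrier[of _ n n p _ n])
  note inv = tinv_T_PD[OF A p]
  note res = geometric_mean_riccati[OF tA(2) tS(2) S(2) pdD(1)[OF tR(2)] R(2)
      pdD(1)[OF T_PD_D(2)[OF inv(1) p]] inv(2) pdD(1)[OF tB(2)] tT(2) T(2)[unfolded bZ]]
  show "A #\<^sub>T B \<in> T_PD n p"
    using res(1) cG by (simp add: T_PD_iff[OF p] bG)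
  show "bcirc (A #\<^sub>T B) * bcirc (tinv A) * bcirc (A #\<^sub>T B) = bcirc B"
    unfolding bG by (rule res(2))
qed

theorem proposition3p4:
  fixes n p :: nat and A B A' B' C :: tensor
  assumes "0 < n" and "0 < p"
    and "A \<in> T_PD n p" and "B \<in> T_PD n p"
    and "A' \<in> T_PD n p" and "B' \<in> T_PD n p"
    and "C \<in> T_Herm n p"
  shows "(A <\<^sub>T B \<longrightarrow> tinv B <\<^sub>T tinv A)
    \<and> (2 \<cdot>\<^sub>T tinv (tinv A +\<^sub>T tinv B) \<le>\<^sub>T A #\<^sub>T B
        \<and> A #\<^sub>T B \<le>\<^sub>T (1 / 2) \<cdot>\<^sub>T (A +\<^sub>T B))
    \<and> (A' \<le>\<^sub>T A \<and> B' \<le>\<^sub>T B \<longrightarrow> A' #\<^sub>T B' \<le>\<^sub>T A #\<^sub>T B)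
    \<and> (C *\<^sub>T C \<le>\<^sub>T A \<and> A \<le>\<^sub>T B \<longrightarrow> C \<le>\<^sub>T tsqrt A \<and> tsqrt A \<le>\<^sub>T tsqrt B)"
proof (intro conjI impI)
  let ?N = "n * p"
  note p = \<open>0 < p\<close>
  note A = assms(3) and B = assms(4) and A' = assms(5) and B' = assms(6) and C = assms(7)
  note D = T_PD_D[OF _ p]
  note iA = tinv_T_PD[OF A p] and iB = tinv_T_PD[OF B p] and iA' = tinv_T_PD[OF A' p]
  note ciA = pdD(1)[OF D(2)[OF iA(1)]] and ciB = pdD(1)[OF D(2)[OF iB(1)]]
    and ciA' = pdD(1)[OF D(2)[OF iA'(1)]]
  note G = tgmean_T_PD[OF A B p] and G' = tgmean_T_PD[OF A' B' p]
  show "tinv B <\<^sub>T tinv A" if "A <\<^sub>T B"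
    using that pd_inverse_antitone[OF D(2)[OF A] D(2)[OF B] ciA iA(2) ciB iB(2)]
    unfolding tless_iff[OF D(3)[OF A] D(3)[OF B] p] tless_iff[OF D(3)[OF iB(1)] D(3)[OF iA(1)] p] by blast
  have scaled: "c \<cdot>\<^sub>T X \<in> T_Herm n p" if "X \<in> T_PD n p" "c \<in> \<real>" for c X
    using that D(1,2)[OF that(1)] p
    by (auto simp: T_Herm_iff bcirc_tsmult tsmult_carrier elim!: Reals_cases
        intro: smult_real_hermitian dest: pd_hermitian)
  have sum: "X +\<^sub>T Y \<in> T_PD n p" "bcirc (X +\<^sub>T Y) = bcirc X + bcirc Y"
    if "X \<in> T_PD n p" "Y \<in> T_PD n p" for X Y
    using D(1,2)[OF that(1)] D(1,2)[OF that(2)] p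
    by (simp_all add: T_PD_iff bcirc_tadd tadd_carrier pd_add_psd pd_imp_psd)
  define W where "W = tinv A +\<^sub>T tinv B"
  have W: "W \<in> T_PD n p" "bcirc W = bcirc (tinv A) + bcirc (tinv B)"
    using sum[OF iA(1) iB(1)] by (simp_all add: W_def)
  note iW = tinv_T_PD[OF W(1) p]
  have "bcirc (A #\<^sub>T B) - 2 \<cdot>\<^sub>m bcirc (tinv W) \<in> psd ?N"
    using harmonic_geometric_mean_mat[OF D(2)[OF A] ciA iA(2) D(2)[OF B] ciB iB(2)
        pdD(1)[OF D(2)[OF iW(1)]] iW(2)[unfolded W(2)] D(2)[OF G(1)] G(2)] .
  then show "2 \<cdot>\<^sub>T tinv (tinv A +\<^sub>T tinv B) \<le>\<^sub>T A #\<^sub>T B"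
    unfolding W_def[symmetric]
    using tless_eq_iff[OF scaled[OF iW(1), of 2] D(3)[OF G(1)] p] bcirc_tsmult[OF D(1)[OF iW(1)] p]
    by simp
  have "(1 / 2) \<cdot>\<^sub>m (bcirc A + bcirc B) - bcirc (A #\<^sub>T B) \<in> psd ?N"
    using arithmetic_geometric_mean_mat[OF D(2)[OF A] ciA iA(2) pd_hermitian[OF D(2)[OF G(1)]] G(2)] .
  then show "A #\<^sub>T B \<le>\<^sub>T (1 / 2) \<cdot>\<^sub>T (A +\<^sub>T B)"
    using tless_eq_iff[OF D(3)[OF G(1)] scaled[OF sum(1)[OF A B], of "1 / 2"] p]
      bcirc_tsmult[OF D(1)[OF sum(1)[OF A B]] p] sum(2)[OF A B]
    by simp
  show "A' #\<^sub>T B' \<le>\<^sub>T A #\<^sub>T B" if "A' \<le>\<^sub>T A \<and> B' \<le>\<^sub>T B"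
  proof -
    have "bcirc A - bcirc A' \<in> psd ?N" "bcirc B - bcirc B' \<in> psd ?N"
      using that tless_eq_iff[OF D(3)[OF A'] D(3)[OF A] p] tless_eq_iff[OF D(3)[OF B'] D(3)[OF B] p]
      by auto
    then have "bcirc (A #\<^sub>T B) - bcirc (A' #\<^sub>T B') \<in> psd ?N"
      by (rule geometric_mean_mono_mat[OF D(2)[OF A] ciA iA(2) D(2)[OF A'] ciA' iA'(2)
            D(2)[OF G(1)] G(2) D(2)[OF G'(1)] G'(2)])
    then show ?thesis
      using tless_eq_iff[OF D(3)[OF G'(1)] D(3)[OF G(1)] p] by simp
  qed
  note sA = tsqrt_T_PD[OF A p] and sB = tsqrt_T_PD[OF B p]
  assume le: "C *\<^sub>T C \<le>\<^sub>T A \<and> A \<le>\<^sub>T B"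
  have cC: "C \<in> tensor_carrier n n p" and hC: "bcirc C \<in> hermitian ?N"
    using C by (auto simp: T_Herm_iff[OF p])
  have "mat_adjoint (bcirc C * bcirc C) = bcirc C * bcirc C"
    using hermitianD[OF hC] by (simp add: mat_adjoint_mult[of _ ?N ?N _ ?N])
  then have CC: "C *\<^sub>T C \<in> T_Herm n p" "bcirc (C *\<^sub>T C) = bcirc C * bcirc C"
    using cC hermitianD(1)[OF hC] p
    by (auto simp: T_Herm_iff bcirc_tprod[of _ n n p _ n] tprod_carrier[of _ n n p _ n] hermitian_def)
  have "bcirc (tsqrt A) * bcirc (tsqrt A) - bcirc C * bcirc C \<in> psd ?N"
    using le tless_eq_iff[OF CC(1) D(3)[OF A] p] by (simp add: sA(2) CC(2))
  then have "bcirc (tsqrt A) - bcirc C \<in> psd ?N"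
    by (rule psd_diff_of_square_le[OF D(2)[OF sA(1)] hC])
  then show "C \<le>\<^sub>T tsqrt A"
    using tless_eq_iff[OF C D(3)[OF sA(1)] p] by simp
  have "bcirc (tsqrt B) * bcirc (tsqrt B) - bcirc (tsqrt A) * bcirc (tsqrt A) \<in> psd ?N"
    using le tless_eq_iff[OF D(3)[OF A] D(3)[OF B] p] by (simp add: sA(2) sB(2))
  then have "bcirc (tsqrt B) - bcirc (tsqrt A) \<in> psd ?N"
    by (rule psd_diff_of_square_le[OF D(2)[OF sB(1)] pd_hermitian[OF D(2)[OF sA(1)]]])
  then show "tsqrt A \<le>\<^sub>T tsqrt B"
    using tless_eq_iff[OF D(3)[OF sA(1)] D(3)[OF sB(1)] p] by simp
qed

end
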